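(* $A(3,4)=5$. Moreover, every spherical design of harmonic index $4$ on $S^2$ with exactly $5$ points is congruent to one of the following two sets $X_0^{+}$, $X_0^{-}$, or to a configuration obtained from $X_0^{+}$ or $X_0^{-}$ by replacing some of its points by their antipodal points: $$\begin{aligned} X_0^{\pm}=\Big\{&\left(\tfrac{1}{35}\sqrt{525\pm70\sqrt{30}},\ \tfrac{1}{35}\sqrt{700\mp70\sqrt{30}},\ 0\right),\\ &\left(\tfrac{1}{35}\sqrt{525\pm70\sqrt{30}},\ \tfrac{\sqrt5-1}{140}\sqrt{700\mp70\sqrt{30}},\ \tfrac{\sqrt{10+2\sqrt5}}{140}\sqrt{700\mp70\sqrt{30}}\right),\\ &\left(\tfrac{1}{35}\sqrt{525\pm70\sqrt{30}},\ -\tfrac{\sqrt5+1}{140}\sqrt{700\mp70\sqrt{30}},\ \tfrac{\sqrt{10-2\sqrt5}}{140}\sqrt{700\mp70\sqrt{30}}\right),\\ &\left(\tfrac{1}{35}\sqrt{525\pm70\sqrt{30}},\ -\tfrac{\sqrt5+1}{140}\sqrt{700\mp70\sqrt{30}},\ -\tfrac{\sqrt{10-2\sqrt5}}{140}\sqrt{700\mp70\sqrt{30}}\right),\\ &\left(\tfrac{1}{35}\sqrt{525\pm70\sqrt{30}},\ \tfrac{\sqrt5-1}{140}\sqrt{700\mp70\sqrt{30}},\ -\tfrac{\sqrt{10+2\sqrt5}}{140}\sqrt{700\mp70\sqrt{30}}\right)\Big\}, \end{aligned}$$ where the double signs correspond: all upper signs give $X_0^{+}$ and all lower signs give $X_0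^{-}$.
   Context: $S^{n-1}$ denotes the unit sphere centered at the origin in $\mathbb{R}^n$. $\mathrm{Harm}_t(\mathbb{R}^n)$ is the space of real homogeneous polynomials $f$ of degree $t$ in $n$ variables with $\Delta f=0$, where $\Delta=\sum_i\partial^2/\partial x_i^2$. A finite nonempty subset $X\subset S^{n-1}$ is a spherical design of harmonic index $t$ if $\sum_{x\in X}f(x)=0$ for every $f\in\mathrm{Harm}_t(\mathbb{R}^n)$. $A(n,t)$ denotes the minimum cardinality of a spherical design of harmonic index $t$ on $S^{n-1}$. Two subsets of $S^2$ are congruent if one is the image of the other under an orthogonal transformation of $\mathbb{R}^3$. The antipodal point of $x$ is $-x$. *)

theory Defs
  imports "HOL-Analysis.Analysis"
begin

text \<open>
  Real polynomials in the variables \<open>x $ i\<close> are represented by their polynomial functions, which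
  loses nothing over the infinite field of reals. The exponent of \<open>x $ i\<close> in a monomial is \<open>a i\<close>,
  and \<open>c a\<close> is the coefficient of that monomial.
\<close>

definition homogeneous_polys :: "nat \<Rightarrow> (real ^ 'n \<Rightarrow> real) set" where
  "homogeneous_polys t =
    {f. \<exists>c. f = (\<lambda>x. \<Sum>a | (\<Sum>i\<in>UNIV. a i) = t. c a * (\<Prod>i\<in>UNIV. (x $ i) ^ a i))}"

text \<open>
  The index set of the sum above is finite, so the sum does not take the default value \<open>0\<close> of
  sums over infinite sets.
\<close>

lemma finite_exponents_of_degree: "finite {a :: 'n::finite \<Rightarrow> nat. (\<Sum>i\<in>UNIV. a i) = t}"
proof (rule finite_subset)
  show "{a :: 'n \<Rightarrow> nat. (\<Sum>i\<in>UNIV. a i) = t} \<subseteq> (\<Pi>\<^sub>E i\<in>UNIV. {..t})"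
    by (auto simp: member_le_sum)
qed (auto intro: finite_PiE)

definition laplacian :: "(real ^ 'n \<Rightarrow> real) \<Rightarrow> real ^ 'n \<Rightarrow> real" where
  "laplacian f x = (\<Sum>i\<in>UNIV. (deriv ^^ 2) (\<lambda>s. f (x + s *\<^sub>R axis i 1)) 0)"

definition Harm :: "nat \<Rightarrow> (real ^ 'n \<Rightarrow> real) set" where
  "Harm t = {f \<in> homogeneous_polys t. \<forall>x. laplacian f x = 0}"

definition harmonic_index_design :: "nat \<Rightarrow> (real ^ 'n) set \<Rightarrow> bool" where
  "harmonic_index_design t X \<longleftrightarrow>
    finite X \<and> X \<noteq> {} \<and> X \<subseteq> sphere 0 1 \<and> (\<forall>f\<in>Harm t. (\<Sum>x\<in>X. f x) = 0)"

text \<open>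
  The dimension \<open>n\<close> is passed as an index type with \<open>n\<close> elements. On \<open>nat\<close> the infimum of a
  nonempty set is its minimum, and \<open>Inf {} = 0\<close>; a positive value is therefore attained by
  a design, since designs are nonempty.
\<close>

definition min_design_card :: "'n::finite itself \<Rightarrow> nat \<Rightarrow> nat" where
  "min_design_card n t = Inf (card ` {X :: (real ^ 'n) set. harmonic_index_design t X})"

definition congruent_sets :: "(real ^ 'n) set \<Rightarrow> (real ^ 'n) set \<Rightarrow> bool" where
  "congruent_sets X Y \<longleftrightarrow> (\<exists>g. orthogonal_transformation g \<and> Y = g ` X)"

text \<open>\<open>S\<close> is the set of points that are replaced; it may be empty.\<close>

definition antipodal_replacement :: "(real ^ 'n) set \<Rightarrow> (real ^ 'n) set \<Rightarrow> bool" where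
  "antipodal_replacement X Y \<longleftrightarrow> (\<exists>S\<subseteq>X. Y = (X - S) \<union> uminus ` S)"

text \<open>\<open>e = 1\<close> selects the upper signs and \<open>e = -1\<close> the lower signs.\<close>

definition pentagon :: "real \<Rightarrow> (real ^ 3) set" where
  "pentagon e =
    (let h = 1 / 35 * sqrt (525 + e * (70 * sqrt 30));
         r = sqrt (700 - e * (70 * sqrt 30))
     in {vector [h, 1 / 35 * r, 0],
         vector [h, (sqrt 5 - 1) / 140 * r, sqrt (10 + 2 * sqrt 5) / 140 * r],
         vector [h, - ((sqrt 5 + 1) / 140) * r, sqrt (10 - 2 * sqrt 5) / 140 * r],
         vector [h, - ((sqrt 5 + 1) / 140) * r, - (sqrt (10 - 2 * sqrt 5) / 140) * r],
         vector [h, (sqrt 5 - 1) / 140 * r, - (sqrt (10 + 2 * sqrt 5) / 140) * r]})"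

definition X0_plus :: "(real ^ 3) set" where
  "X0_plus = pentagon 1"

definition X0_minus :: "(real ^ 3) set" where
  "X0_minus = pentagon (-1)"

end

theory Submission
  imports Defs
begin

text \<open>
  Testing the design against zonal harmonics says that \<open>\<Sum> (p \<bullet> y)^4 = |y|^2 q(y)\<close> for a quadratic form \<open>q\<close>,
  which fixes all quartic moments of \<open>X\<close> in terms of the quadratic ones. At most five points lie on a
  conic \<open>c\<close>, which may be taken traceless if there are at most four. In an orthonormal frame that diagonalises
  \<open>c\<close>, summing \<open>c(p) p_i p_j\<close> over \<open>X\<close> gives \<open>b_i (t + 4 c_i) = 3 |X| t / 35\<close> with \<open>t = tr c\<close> and
  \<open>b_i = \<Sum> p_i^4 > 0\<close>. So a traceless conic vanishes, and \<open>|X| \<ge> 5\<close>.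

  For \<open>|X| = 5\<close> put \<open>u_i = 1 + 4 c_i / t\<close>. The five points restrict the quadratic forms to a five-dimensional
  space of functions with an explicit orthogonal basis, and the transpose of an orthogonal matrix is orthogonal.
  If the \<open>u_i\<close> are distinct, the squared coordinates lie on a line and satisfy a quadratic equation with nonzero
  linear term on it, so they take at most two values; a parity argument excludes this. If two \<open>u_i\<close> agree,
  the points have constant height \<open>\<plusminus>\<surd>H\<close> over a plane, and orthogonality of the transpose says that after sign
  changes the cosine \<open>a\<close> between any two projections to that plane satisfies \<open>4 a^2 + 2 a - 1 = 0\<close>,
  the equation of a regular pentagon.
\<close>

subsection \<open>Zonal harmonics\<close>

lemma homogeneous_polysI:
  assumes "\<And>x. f x = (\<Sum>a | (\<Sum>i\<in>UNIV. a i) = t. c a * (\<Prod>i\<in>UNIV. (x $ i) ^ a i))"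
  shows "f \<in> homogeneous_polys t"
  unfolding homogeneous_polys_def using assms by blast

lemma homogeneous_polys_add:
  assumes "f \<in> homogeneous_polys t" "g \<in> homogeneous_polys t"
  shows "(\<lambda>x. f x + g x) \<in> homogeneous_polys t"
proof -
  obtain c d where "f = (\<lambda>x. \<Sum>a | (\<Sum>i\<in>UNIV. a i) = t. c a * (\<Prod>i\<in>UNIV. (x $ i) ^ a i))"
    "g = (\<lambda>x. \<Sum>a | (\<Sum>i\<in>UNIV. a i) = t. d a * (\<Prod>i\<in>UNIV. (x $ i) ^ a i))"
    using assms unfolding homogeneous_polys_def by blast
  then show ?thesis
    by (intro homogeneous_polysI[where c = "\<lambda>a. c a + d a"]) (simp add: distrib_right sum.distrib)
qed

lemma homogeneous_polys_cmult:
  assumes "f \<in> homogeneous_polys t"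
  shows "(\<lambda>x. k * f x) \<in> homogeneous_polys t"
proof -
  obtain c where "f = (\<lambda>x. \<Sum>a | (\<Sum>i\<in>UNIV. a i) = t. c a * (\<Prod>i\<in>UNIV. (x $ i) ^ a i))"
    using assms unfolding homogeneous_polys_def by blast
  then show ?thesis
    by (intro homogeneous_polysI[where c = "\<lambda>a. k * c a"]) (simp add: sum_distrib_left mult.assoc)
qed

lemma homogeneous_polys_mult:
  fixes f g :: "real ^ 'n \<Rightarrow> real"
  assumes "f \<in> homogeneous_polys s" "g \<in> homogeneous_polys t"
  shows "(\<lambda>x. f x * g x) \<in> homogeneous_polys (s + t)"
proof -
  let ?E = "\<lambda>t. {a :: 'n \<Rightarrow> nat. (\<Sum>i\<in>UNIV. a i) = t}"
  let ?m = "\<lambda>(x :: real ^ 'n) a. \<Prod>i\<in>UNIV. (x $ i) ^ a i"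
  obtain c d where c: "f = (\<lambda>x. \<Sum>a\<in>?E s. c a * ?m x a)" and d: "g = (\<lambda>x. \<Sum>a\<in>?E t. d a * ?m x a)"
    using assms unfolding homogeneous_polys_def by blast
  let ?h = "\<lambda>p :: ('n \<Rightarrow> nat) \<times> ('n \<Rightarrow> nat). \<lambda>i. fst p i + snd p i"
  let ?P = "?E s \<times> ?E t"
  \<comment> \<open>The coefficients of a product are the convolution of the coefficients;
    \<open>sum.group\<close> below collects the pairs of exponents by their sum.\<close>
  define k where "k = (\<lambda>e. \<Sum>p\<in>{p\<in>?P. ?h p = e}. c (fst p) * d (snd p))"
  show ?thesis
  proof (rule homogeneous_polysI[where c = k])
    fix x
    have "f x * g x = (\<Sum>p\<in>?P. c (fst p) * d (snd p) * ?m x (?h p))"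
      unfolding c d by (simp add: sum_product sum.cartesian_product power_add prod.distrib
          case_prod_beta mult_ac)
    also have "\<dots> = (\<Sum>e\<in>?E (s + t). \<Sum>p\<in>{p\<in>?P. ?h p = e}. c (fst p) * d (snd p) * ?m x (?h p))"
      by (rule sum.group[symmetric])
        (auto simp: finite_exponents_of_degree sum.distrib)
    also have "\<dots> = (\<Sum>e\<in>?E (s + t). k e * ?m x e)"
      unfolding k_def sum_distrib_right by (intro sum.cong refl) auto
    finally show "f x * g x = (\<Sum>e\<in>?E (s + t). k e * ?m x e)" .
  qed
qed

lemma coordinate_homogeneous: "(\<lambda>x :: real ^ 'n. x $ j) \<in> homogeneous_polys 1"
proof (rule homogeneous_polysI[where c = "\<lambda>a. if a = (\<lambda>i. if i = j then 1 else 0) then 1 else 0"])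
  fix x :: "real ^ 'n"
  let ?a = "\<lambda>i. if i = j then 1 else 0 :: nat"
  have "(\<Sum>a | (\<Sum>i\<in>UNIV. a i) = 1. (if a = ?a then 1 else 0) * (\<Prod>i\<in>UNIV. (x $ i) ^ a i))
    = (\<Sum>a\<in>{a. (\<Sum>i\<in>UNIV. a i) = 1}. if a = ?a then (\<Prod>i\<in>UNIV. (x $ i) ^ a i) else 0)"
    by (rule sum.cong) auto
  also have "\<dots> = (\<Prod>i\<in>UNIV. (x $ i) ^ ?a i)"
    using finite_exponents_of_degree[of 1] by (subst sum.delta) auto
  also have "\<dots> = (\<Prod>i\<in>UNIV. if i = j then x $ i else 1)"
    by (rule prod.cong) auto
  finally show "x $ j = (\<Sum>a | (\<Sum>i\<in>UNIV. a i) = 1. (if a = ?a then 1 else 0) * (\<Prod>i\<in>UNIV. (x $ i) ^ a i))"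
    by simp
qed

lemma homogeneous_polys_sum:
  assumes "finite J" "\<And>j. j \<in> J \<Longrightarrow> f j \<in> homogeneous_polys t"
  shows "(\<lambda>x. \<Sum>j\<in>J. f j x) \<in> homogeneous_polys t"
  using assms
proof (induction J)
  case empty
  then show ?case
    by (auto intro: homogeneous_polysI[where c = "\<lambda>_. 0"])
qed (auto intro: homogeneous_polys_add)

lemma inner_homogeneous: "(\<lambda>x. x \<bullet> y) \<in> homogeneous_polys 1"
  unfolding inner_vec_def inner_real_def
  by (subst mult.commute) (intro homogeneous_polys_sum homogeneous_polys_cmult coordinate_homogeneous finite)

lemma norm_squared_homogeneous: "(\<lambda>x. x \<bullet> x) \<in> homogeneous_polys 2"
  unfolding inner_vec_def inner_real_def
  using homogeneous_polys_mult[OF coordinate_homogeneous coordinate_homogeneous]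
  by (intro homogeneous_polys_sum) (auto simp: numeral_2_eq_2)

text \<open>Up to the factor 8/35 this is |x|^4 |y|^4 P_4(s), where s is the cosine of the angle
  between \<open>x\<close> and \<open>y\<close> and P_4(s) = (35 s^4 - 30 s^2 + 3) / 8 is the
  Legendre polynomial.\<close>

definition zonal :: "real ^ 3 \<Rightarrow> real ^ 3 \<Rightarrow> real" where
  "zonal y x = (x \<bullet> y) ^ 4 - 6 / 7 * (y \<bullet> y) * ((x \<bullet> y)\<^sup>2 * (x \<bullet> x)) + 3 / 35 * (y \<bullet> y)\<^sup>2 * (x \<bullet> x)\<^sup>2"

lemma zonal_homogeneous: "zonal y \<in> homogeneous_polys 4"
proof -
  have 2: "(\<lambda>x. (x \<bullet> y)\<^sup>2) \<in> homogeneous_polys 2"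
    using homogeneous_polys_mult[OF inner_homogeneous inner_homogeneous, of y y]
    by (simp add: power2_eq_square numeral_2_eq_2)
  have 4: "(\<lambda>x. (x \<bullet> y)\<^sup>2 * (x \<bullet> y)\<^sup>2) \<in> homogeneous_polys 4"
    "(\<lambda>x. (x \<bullet> y)\<^sup>2 * (x \<bullet> x)) \<in> homogeneous_polys 4"
    "(\<lambda>x. (x \<bullet> x) * (x \<bullet> x)) \<in> homogeneous_polys 4"
    using homogeneous_polys_mult[OF 2 2] homogeneous_polys_mult[OF 2 norm_squared_homogeneous]
      homogeneous_polys_mult[OF norm_squared_homogeneous norm_squared_homogeneous] by auto
  have "zonal y = (\<lambda>x. (x \<bullet> y)\<^sup>2 * (x \<bullet> y)\<^sup>2 +
      (- (6 / 7 * (y \<bullet> y)) * ((x \<bullet> y)\<^sup>2 * (x \<bullet> x)) + 3 / 35 * (y \<bullet> y)\<^sup>2 * ((x \<bullet> x) * (x \<bullet> x))))"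
    by (rule ext) (simp add: zonal_def power2_eq_square power4_eq_xxxx)
  also have "\<dots> \<in> homogeneous_polys 4"
    by (intro homogeneous_polys_add homogeneous_polys_cmult 4)
  finally show ?thesis .
qed

lemma second_deriv_eq:
  fixes f :: "real \<Rightarrow> real"
  assumes "\<And>s. (f has_real_derivative f' s) (at s)" "(f' has_real_derivative D) (at a)"
  shows "(deriv ^^ 2) f a = D"
proof -
  have "deriv f = f'"
    using assms(1) by (auto intro: DERIV_imp_deriv)
  then show ?thesis
    using assms(2) by (simp add: numeral_2_eq_2 DERIV_imp_deriv)
qed

lemma laplacian_zonal: "laplacian (zonal y) x = 0"
proof -
  \<comment> \<open>This is twice the coefficient of s^2 on the line in direction \<open>i\<close>.
    Summed over three coordinates, the constants 6/7 and 3/35 make all terms cancel; this is where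
    the dimension enters.\<close>
  have "(deriv ^^ 2) (\<lambda>s. zonal y (x + s *\<^sub>R axis i 1)) 0 =
      12 * (x \<bullet> y)\<^sup>2 * (y $ i)\<^sup>2
      - 6 / 7 * (y \<bullet> y) * (2 * (y $ i)\<^sup>2 * (x \<bullet> x) + 8 * (x \<bullet> y) * y $ i * x $ i + 2 * (x \<bullet> y)\<^sup>2)
      + 3 / 35 * (y \<bullet> y)\<^sup>2 * (8 * (x $ i)\<^sup>2 + 4 * (x \<bullet> x))" for i
  proof -
    have exp: "zonal y (x + s *\<^sub>R axis i 1) =
      (x \<bullet> y + s * y $ i) ^ 4 - 6 / 7 * (y \<bullet> y) * ((x \<bullet> y + s * y $ i)\<^sup>2 * (x \<bullet> x + 2 * s * x $ i + s\<^sup>2))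
      + 3 / 35 * (y \<bullet> y)\<^sup>2 * (x \<bullet> x + 2 * s * x $ i + s\<^sup>2)\<^sup>2" for s
      unfolding zonal_def
      by (simp add: inner_add_left inner_add_right inner_axis inner_axis' power2_eq_square
          algebra_simps)
    show ?thesis
      unfolding exp
      apply (rule second_deriv_eq)
       apply (rule derivative_eq_intros refl | simp)+
      apply (simp add: power2_eq_square algebra_simps)
      done
  qed
  note D = this
  show ?thesis
    unfolding laplacian_def D inner_vec_def sum_3 inner_real_def
    by (simp add: field_simps) algebra
qed

text \<open>The classification tests a design against zonal harmonics only. All of
  \<open>Harm 4\<close> has to be treated only when the pentagon is shown to be a design.\<close>

lemma design_zonal_sum:
  fixes X :: "(real ^ 3) set"
  assumes "harmonic_index_design 4 X"
  shows "(\<Sum>x\<in>X. (x \<bullet> y) ^ 4 - 6 / 7 * (x \<bullet> y)\<^sup>2 * (y \<bullet> y) + 3 / 35 * (y \<bullet> y)\<^sup>2) = 0"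
proof -
  have "zonal y \<in> Harm 4"
    by (simp add: Harm_def zonal_homogeneous laplacian_zonal)
  then have "(\<Sum>x\<in>X. zonal y x) = 0"
    using assms by (simp add: harmonic_index_design_def)
  moreover have "x \<bullet> x = 1" if "x \<in> X" for x
    using that assms by (auto simp: harmonic_index_design_def norm_eq_1)
  ultimately show ?thesis
    by (simp add: zonal_def mult_ac cong: sum.cong)
qed

subsection \<open>Diagonalising a quadratic form\<close>

text \<open>Take \<open>e\<close> to be a maximiser of the quadratic form on the compact unit sphere
  of \<open>S\<close>. Its first variation in every orthogonal direction vanishes.\<close>

lemma bilinear_form_max_orthogonal:
  fixes \<beta> :: "'a::euclidean_space \<Rightarrow> 'a \<Rightarrow> real"
  assumes \<beta>: "bilinear \<beta>" and sym: "\<And>x y. \<beta> x y = \<beta> y x"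
    and S: "subspace S" "S \<noteq> {0}"
  obtains e where "e \<in> S" "norm e = 1" "\<And>v. v \<in> S \<Longrightarrow> e \<bullet> v = 0 \<Longrightarrow> \<beta> e v = 0"
proof -
  let ?K = "S \<inter> sphere 0 1"
  obtain w where w: "w \<in> S" "w \<noteq> 0"
    using S subspace_0 by blast
  have "(1 / norm w) *\<^sub>R w \<in> ?K"
    using w S(1) by (simp add: subspace_scale)
  then have "?K \<noteq> {}" by blast
  moreover have "compact ?K"
    using S(1) by (simp add: closed_Int_compact closed_subspace)
  moreover have "continuous_on ?K (\<lambda>x. \<beta> x x)"
    using bilinear_continuous_on_compose[OF continuous_on_id continuous_on_id \<beta>] by simp
  ultimately obtain e where e: "e \<in> ?K" and max: "\<And>x. x \<in> ?K \<Longrightarrow> \<beta> x x \<le> \<beta> e e"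
    using continuous_attains_sup by meson
  have le: "\<beta> x x \<le> \<beta> e e * (x \<bullet> x)" if "x \<in> S" for x
  proof (cases "x = 0")
    case False
    have "(1 / norm x) *\<^sub>R x \<in> ?K"
      using that False S(1) by (simp add: subspace_scale)
    from max[OF this] have "\<beta> x x / (norm x)\<^sup>2 \<le> \<beta> e e"
      by (simp add: bilinear_lmul[OF \<beta>] bilinear_rmul[OF \<beta>] power2_eq_square)
    then show ?thesis
      using False by (simp add: divide_le_eq power2_norm_eq_inner)
  qed (simp add: bilinear_lzero[OF \<beta>])
  show ?thesis
  proof
    show "e \<in> S" "norm e = 1" using e by auto
    fix v assume v: "v \<in> S" "e \<bullet> v = 0"
    \<comment> \<open>Maximality compared at \<open>e + s v\<close>, with the common term
      cancelled.\<close>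
    have "0 \<le> s * (s * (\<beta> e e * (v \<bullet> v) - \<beta> v v) - 2 * \<beta> e v)" for s
    proof -
      have "e + s *\<^sub>R v \<in> S"
        using e v S(1) by (simp add: subspace_add subspace_scale)
      from le[OF this] show ?thesis
        using e v(2) sym[of v e]
        by (simp add: bilinear_ladd[OF \<beta>] bilinear_radd[OF \<beta>] bilinear_lmul[OF \<beta>] bilinear_rmul[OF \<beta>]
            inner_add_left inner_add_right inner_commute norm_eq_1 algebra_simps)
    qed
    note q = this
    \<comment> \<open>As \<open>k\<close> is positive and exceeds the coefficient of s^2, the linear
      term wins at s = b / k unless \<open>b\<close> is zero.\<close>
    define k b where "k = \<bar>\<beta> e e * (v \<bullet> v) - \<beta> v v\<bar> + 1" and "b = \<beta> e v"
    have k: "k > 0" "\<beta> e e * (v \<bullet> v) - \<beta> v v < k" by (auto simp: k_def)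
    have "0 \<le> (b / k) * ((b / k) * (\<beta> e e * (v \<bullet> v) - \<beta> v v) - 2 * b)"
      using q[of "b / k"] by (simp add: b_def)
    also have "\<dots> = (b / k)\<^sup>2 * (\<beta> e e * (v \<bullet> v) - \<beta> v v) - 2 * (b / k)\<^sup>2 * k"
      using k(1) by (simp add: power2_eq_square field_simps)
    also have "\<dots> \<le> (b / k)\<^sup>2 * k - 2 * (b / k)\<^sup>2 * k"
      using k(2) by (intro diff_right_mono mult_left_mono) auto
    also have "\<dots> = - (b\<^sup>2 / k)"
      using k(1) by (simp add: power2_eq_square field_simps)
    finally have "b\<^sup>2 / k \<le> 0" by simp
    then show "\<beta> e v = 0"
      using k(1) by (simp add: b_def divide_le_0_iff)
  qed
qed

lemma orthonormal_frame_expansion: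
  fixes e1 e2 e3 x :: "real ^ 3"
  assumes "norm e1 = 1" "norm e2 = 1" "norm e3 = 1" "e1 \<bullet> e2 = 0" "e1 \<bullet> e3 = 0" "e2 \<bullet> e3 = 0"
  shows "x = (x \<bullet> e1) *\<^sub>R e1 + (x \<bullet> e2) *\<^sub>R e2 + (x \<bullet> e3) *\<^sub>R e3"
proof -
  let ?B = "{e1, e2, e3}"
  have ne: "e1 \<noteq> e2" "e1 \<noteq> e3" "e2 \<noteq> e3"
    using assms by (auto simp: norm_eq_1)
  have po: "pairwise orthogonal ?B"
    using assms by (auto simp: pairwise_def orthogonal_def inner_commute)
  have "independent ?B"
    using pairwise_orthogonal_independent[OF po] assms(1-3) by fastforce
  then have "dim ?B = DIM(real ^ 3)"
    using ne by (simp add: dim_eq_card_independent)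
  then have "x \<in> span ?B"
    by (metis UNIV_I dim_eq_full)
  then have "(\<Sum>b\<in>?B. (x \<bullet> b) *\<^sub>R b) = x"
    using assms(1-3) by (intro orthonormal_basis_expand[OF po]) auto
  then show ?thesis
    using ne by (simp add: add.assoc)
qed

text \<open>The spectral theorem in dimension three: maximise in turn over the space, over the plane
  orthogonal to \<open>e1\<close>, and over the line orthogonal to \<open>e1\<close> and
  \<open>e2\<close>.\<close>

lemma quadratic_form_diagonal:
  fixes \<beta> :: "real ^ 3 \<Rightarrow> real ^ 3 \<Rightarrow> real"
  assumes \<beta>: "bilinear \<beta>" and sym: "\<And>x y. \<beta> x y = \<beta> y x"
  obtains e1 e2 e3 c1 c2 c3 where
    "norm e1 = 1" "norm e2 = 1" "norm e3 = 1" "e1 \<bullet> e2 = 0" "e1 \<bullet> e3 = 0" "e2 \<bullet> e3 = 0"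
    "\<And>x. \<beta> x x = c1 * (x \<bullet> e1)\<^sup>2 + c2 * (x \<bullet> e2)\<^sup>2 + c3 * (x \<bullet> e3)\<^sup>2"
proof -
  \<comment> \<open>Two vectors cannot span the space. Taking both equal covers a single
    hyperplane.\<close>
  have hyp: "{v :: real ^ 3. a \<bullet> v = 0} \<inter> {v. b \<bullet> v = 0} \<noteq> {0}" for a b
  proof -
    have "dim (span {a, b}) < DIM(real ^ 3)"
      using order.trans[OF dim_le_card[of "{a, b}" "{a, b}"] card_insert_le_m1[of 2 "{b}" a]]
      by (simp add: span_superset)
    then obtain v where "v \<noteq> 0" "\<And>y. y \<in> span (span {a, b}) \<Longrightarrow> orthogonal v y"
      using orthogonal_to_subspace_exists[of "span {a, b}"] by (metis span_span)
    then have "v \<in> {v. a \<bullet> v = 0} \<inter> {v. b \<bullet> v = 0}"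
      by (simp add: orthogonal_def span_base inner_commute)
    then show ?thesis using \<open>v \<noteq> 0\<close> by blast
  qed
  obtain e1 where e1: "norm e1 = 1" "\<And>v. e1 \<bullet> v = 0 \<Longrightarrow> \<beta> e1 v = 0"
    using bilinear_form_max_orthogonal[OF \<beta> sym subspace_UNIV] by (metis UNIV_I UNIV_not_singleton)
  obtain e2 where e2: "norm e2 = 1" "e1 \<bullet> e2 = 0" "\<And>v. e1 \<bullet> v = 0 \<Longrightarrow> e2 \<bullet> v = 0 \<Longrightarrow> \<beta> e2 v = 0"
    using bilinear_form_max_orthogonal[OF \<beta> sym subspace_hyperplane[of e1]] hyp[of e1 e1]
    by auto
  obtain e3 where e3: "norm e3 = 1" "e1 \<bullet> e3 = 0" "e2 \<bullet> e3 = 0"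
    using bilinear_form_max_orthogonal[OF \<beta> sym subspace_inter[OF subspace_hyperplane[of e1] subspace_hyperplane[of e2]] hyp]
    by auto
  have z: "\<beta> e1 e2 = 0" "\<beta> e1 e3 = 0" "\<beta> e2 e3 = 0" "\<beta> e2 e1 = 0" "\<beta> e3 e1 = 0" "\<beta> e3 e2 = 0"
    using e1 e2 e3 sym by metis+
  show ?thesis
  proof
    fix x
    let ?s = "(x \<bullet> e1) *\<^sub>R e1 + (x \<bullet> e2) *\<^sub>R e2 + (x \<bullet> e3) *\<^sub>R e3"
    have "\<beta> x x = \<beta> ?s ?s"
      using orthonormal_frame_expansion[OF e1(1) e2(1) e3(1) e2(2) e3(2,3), of x] by simp
    also have "\<dots> = \<beta> e1 e1 * (x \<bullet> e1)\<^sup>2 + \<beta> e2 e2 * (x \<bullet> e2)\<^sup>2 + \<beta> e3 e3 * (x \<bullet> e3)\<^sup>2"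
      by (simp add: bilinear_ladd[OF \<beta>] bilinear_radd[OF \<beta>] bilinear_lmul[OF \<beta>] bilinear_rmul[OF \<beta>]
          z power2_eq_square)
    finally show "\<beta> x x = \<beta> e1 e1 * (x \<bullet> e1)\<^sup>2 + \<beta> e2 e2 * (x \<bullet> e2)\<^sup>2 + \<beta> e3 e3 * (x \<bullet> e3)\<^sup>2" .
  qed (use e1 e2 e3 in auto)
qed

subsection \<open>Moments of a design\<close>

text \<open>Shaped to match one summand of \<open>moment_expansion\<close>: \<open>p\<close> and
  \<open>q\<close> stand for 6/7 and 3/35, \<open>s\<close> and \<open>r\<close> for the squared
  norm of the pole and its square. The factor 1 is the summand of the cardinality.\<close>

lemma ternary_quartic_expansion:
  fixes \<alpha> \<beta> \<gamma> x y z p q r s :: real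
  shows "\<alpha> ^ 4 * x ^ 4 + \<beta> ^ 4 * y ^ 4 + \<gamma> ^ 4 * z ^ 4
   + 4 * \<alpha> ^ 3 * \<beta> * (x ^ 3 * y) + 4 * \<alpha> * \<beta> ^ 3 * (x * y ^ 3)
   + 4 * \<beta> ^ 3 * \<gamma> * (y ^ 3 * z) + 4 * \<beta> * \<gamma> ^ 3 * (y * z ^ 3)
   + 4 * \<alpha> ^ 3 * \<gamma> * (x ^ 3 * z) + 4 * \<alpha> * \<gamma> ^ 3 * (x * z ^ 3)
   + 6 * \<alpha>\<^sup>2 * \<beta>\<^sup>2 * (x\<^sup>2 * y\<^sup>2) + 6 * \<beta>\<^sup>2 * \<gamma>\<^sup>2 * (y\<^sup>2 * z\<^sup>2)
   + 6 * \<alpha>\<^sup>2 * \<gamma>\<^sup>2 * (x\<^sup>2 * z\<^sup>2)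
   + 12 * \<alpha>\<^sup>2 * \<beta> * \<gamma> * (x\<^sup>2 * (y * z))
   + 12 * \<alpha> * \<beta>\<^sup>2 * \<gamma> * (y\<^sup>2 * (x * z))
   + 12 * \<alpha> * \<beta> * \<gamma>\<^sup>2 * (z\<^sup>2 * (x * y))
   - p * s * (\<alpha>\<^sup>2 * x\<^sup>2 + \<beta>\<^sup>2 * y\<^sup>2 + \<gamma>\<^sup>2 * z\<^sup>2
     + 2 * \<alpha> * \<beta> * (x * y) + 2 * \<beta> * \<gamma> * (y * z) + 2 * \<alpha> * \<gamma> * (x * z))
   + q * r * 1
   = (\<alpha> * x + \<beta> * y + \<gamma> * z) ^ 4 - p * (\<alpha> * x + \<beta> * y + \<gamma> * z)\<^sup>2 * s + q * r"
  by algebra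

text \<open>\<open>x\<close>, \<open>y\<close>, \<open>z\<close> are the coordinates of the points
  in an orthonormal frame chosen later, and \<alpha>, \<beta>, \<gamma> those of the pole of a zonal
  harmonic. Keeping the coordinates abstract lets the axes be permuted.\<close>

locale design_frame =
  fixes I :: "'i set" and x y z :: "'i \<Rightarrow> real"
  assumes finite_I: "finite I" and nonempty_I: "I \<noteq> {}"
    and unit: "k \<in> I \<Longrightarrow> (x k)\<^sup>2 + (y k)\<^sup>2 + (z k)\<^sup>2 = 1"
    and zonal_sum: "(\<Sum>k\<in>I. (\<alpha> * x k + \<beta> * y k + \<gamma> * z k) ^ 4
      - 6 / 7 * (\<alpha> * x k + \<beta> * y k + \<gamma> * z k)\<^sup>2 * (\<alpha>\<^sup>2 + \<beta>\<^sup>2 + \<gamma>\<^sup>2)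
      + 3 / 35 * (\<alpha>\<^sup>2 + \<beta>\<^sup>2 + \<gamma>\<^sup>2)\<^sup>2) = 0"
begin

lemma rotate: "design_frame I y z x"
proof
  show "(y k)\<^sup>2 + (z k)\<^sup>2 + (x k)\<^sup>2 = 1" if "k \<in> I" for k
    using unit[OF that] by simp
next
  fix \<alpha> \<beta> \<gamma> :: real
  show "(\<Sum>k\<in>I. (\<alpha> * y k + \<beta> * z k + \<gamma> * x k) ^ 4
      - 6 / 7 * (\<alpha> * y k + \<beta> * z k + \<gamma> * x k)\<^sup>2 * (\<alpha>\<^sup>2 + \<beta>\<^sup>2 + \<gamma>\<^sup>2)
      + 3 / 35 * (\<alpha>\<^sup>2 + \<beta>\<^sup>2 + \<gamma>\<^sup>2)\<^sup>2) = 0"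
    using zonal_sum[of \<gamma> \<alpha> \<beta>] by (simp only: add.commute add.left_commute)
qed (fact finite_I nonempty_I)+

text \<open>The zonal identity is a polynomial identity in \<alpha>, \<beta>, \<gamma> whose
  coefficients are moments. Evaluating it at small integers isolates each of them.\<close>

lemma moment_expansion:
  "\<alpha> ^ 4 * (\<Sum>k\<in>I. (x k) ^ 4) + \<beta> ^ 4 * (\<Sum>k\<in>I. (y k) ^ 4) + \<gamma> ^ 4 * (\<Sum>k\<in>I. (z k) ^ 4)
   + 4 * \<alpha> ^ 3 * \<beta> * (\<Sum>k\<in>I. (x k) ^ 3 * y k) + 4 * \<alpha> * \<beta> ^ 3 * (\<Sum>k\<in>I. x k * (y k) ^ 3)
   + 4 * \<beta> ^ 3 * \<gamma> * (\<Sum>k\<in>I. (y k) ^ 3 * z k) + 4 * \<beta> * \<gamma> ^ 3 * (\<Sum>k\<in>I. y k * (z k) ^ 3)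
   + 4 * \<alpha> ^ 3 * \<gamma> * (\<Sum>k\<in>I. (x k) ^ 3 * z k) + 4 * \<alpha> * \<gamma> ^ 3 * (\<Sum>k\<in>I. x k * (z k) ^ 3)
   + 6 * \<alpha>\<^sup>2 * \<beta>\<^sup>2 * (\<Sum>k\<in>I. (x k)\<^sup>2 * (y k)\<^sup>2) + 6 * \<beta>\<^sup>2 * \<gamma>\<^sup>2 * (\<Sum>k\<in>I. (y k)\<^sup>2 * (z k)\<^sup>2)
   + 6 * \<alpha>\<^sup>2 * \<gamma>\<^sup>2 * (\<Sum>k\<in>I. (x k)\<^sup>2 * (z k)\<^sup>2)
   + 12 * \<alpha>\<^sup>2 * \<beta> * \<gamma> * (\<Sum>k\<in>I. (x k)\<^sup>2 * (y k * z k))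
   + 12 * \<alpha> * \<beta>\<^sup>2 * \<gamma> * (\<Sum>k\<in>I. (y k)\<^sup>2 * (x k * z k))
   + 12 * \<alpha> * \<beta> * \<gamma>\<^sup>2 * (\<Sum>k\<in>I. (z k)\<^sup>2 * (x k * y k))
   - 6 / 7 * (\<alpha>\<^sup>2 + \<beta>\<^sup>2 + \<gamma>\<^sup>2) * (\<alpha>\<^sup>2 * (\<Sum>k\<in>I. (x k)\<^sup>2) + \<beta>\<^sup>2 * (\<Sum>k\<in>I. (y k)\<^sup>2) + \<gamma>\<^sup>2 * (\<Sum>k\<in>I. (z k)\<^sup>2)
     + 2 * \<alpha> * \<beta> * (\<Sum>k\<in>I. x k * y k) + 2 * \<beta> * \<gamma> * (\<Sum>k\<in>I. y k * z k) + 2 * \<alpha> * \<gamma> * (\<Sum>k\<in>I. x k * z k))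
   + 3 / 35 * (\<alpha>\<^sup>2 + \<beta>\<^sup>2 + \<gamma>\<^sup>2)\<^sup>2 * real (card I) = 0" (is "?L = 0")
proof -
  have "real (card I) = (\<Sum>k\<in>I. 1)" by simp
  then have "?L = (\<Sum>k\<in>I. (\<alpha> * x k + \<beta> * y k + \<gamma> * z k) ^ 4
      - 6 / 7 * (\<alpha> * x k + \<beta> * y k + \<gamma> * z k)\<^sup>2 * (\<alpha>\<^sup>2 + \<beta>\<^sup>2 + \<gamma>\<^sup>2)
      + 3 / 35 * (\<alpha>\<^sup>2 + \<beta>\<^sup>2 + \<gamma>\<^sup>2)\<^sup>2)"
    apply (simp only: sum_distrib_left sum.distrib[symmetric] sum_subtractf[symmetric])
    apply (rule sum.cong[OF refl])
    apply (rule ternary_quartic_expansion)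
    done
  then show ?thesis by (simp only: zonal_sum)
qed

lemma moment_x4: "(\<Sum>k\<in>I. (x k) ^ 4) = 6 / 7 * (\<Sum>k\<in>I. (x k)\<^sup>2) - 3 / 35 * real (card I)"
  using moment_expansion[of 1 0 0, simplified] by algebra

text \<open>Differences between \<beta> = 1 and \<beta> = -1 keep the terms odd in \<beta>. The
  choices \<alpha> = 1 and \<alpha> = 2 then give two independent equations for the moments of x^3 y
  and x y^3.\<close>

lemma moment_x3y: "(\<Sum>k\<in>I. (x k) ^ 3 * y k) = 3 / 7 * (\<Sum>k\<in>I. x k * y k)"
  using moment_expansion[of 1 1 0, simplified] moment_expansion[of 1 "-1" 0, simplified]
    moment_expansion[of 2 1 0, simplified] moment_expansion[of 2 "-1" 0, simplified] by algebra

lemma moment_xy3: "(\<Sum>k\<in>I. x k * (y k) ^ 3) = 3 / 7 * (\<Sum>k\<in>I. x k * y k)"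
  using moment_expansion[of 1 1 0, simplified] moment_expansion[of 1 "-1" 0, simplified]
    moment_expansion[of 2 1 0, simplified] moment_expansion[of 2 "-1" 0, simplified] by algebra

lemma moment_x2y2:
  "(\<Sum>k\<in>I. (x k)\<^sup>2 * (y k)\<^sup>2) = 1 / 7 * ((\<Sum>k\<in>I. (x k)\<^sup>2) + (\<Sum>k\<in>I. (y k)\<^sup>2)) - 1 / 35 * real (card I)"
  using moment_expansion[of 1 1 0, simplified] moment_expansion[of 1 "-1" 0, simplified]
    moment_expansion[of 1 0 0, simplified] moment_expansion[of 0 1 0, simplified] by algebra

text \<open>Adding over the sign of \<alpha> and subtracting over the sign of \<gamma> leaves this
  moment together with those of y^3 z and y z^3, which the evaluations at \<alpha> = 0
  remove.\<close>

lemma moment_x2yz: "(\<Sum>k\<in>I. (x k)\<^sup>2 * (y k * z k)) = 1 / 7 * (\<Sum>k\<in>I. y k * z k)"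
  using moment_expansion[of 1 1 1, simplified] moment_expansion[of "-1" 1 1, simplified]
    moment_expansion[of 1 1 "-1", simplified] moment_expansion[of "-1" 1 "-1", simplified]
    moment_expansion[of 0 1 1, simplified] moment_expansion[of 0 1 "-1", simplified] by algebra

lemma moment_trace: "(\<Sum>k\<in>I. (x k)\<^sup>2) + (\<Sum>k\<in>I. (y k)\<^sup>2) + (\<Sum>k\<in>I. (z k)\<^sup>2) = real (card I)"
proof -
  have "(\<Sum>k\<in>I. (x k)\<^sup>2) + (\<Sum>k\<in>I. (y k)\<^sup>2) + (\<Sum>k\<in>I. (z k)\<^sup>2) = (\<Sum>k\<in>I. 1)"
    unfolding sum.distrib[symmetric] by (rule sum.cong) (auto simp: unit)
  then show ?thesis by simp
qed

end

text \<open>Each fact is now available for cyclically permuted axes: \<open>yzx\<close> is one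
  rotation, \<open>yzx.yzx\<close> two, and a third returns to the start.\<close>

sublocale design_frame \<subseteq> yzx: design_frame I y z x
  by (fact rotate)

text \<open>
  The matrix \<open>P\<close> in the proof is the projection onto the span of the \<open>f a\<close>; the squared norm of \<open>1 - P\<close> is its
  trace, which is \<open>card I - card J = 0\<close>.
\<close>

lemma dual_orthogonality:
  fixes f :: "'a \<Rightarrow> 'i \<Rightarrow> real"
  assumes fin: "finite I" "finite J" and card: "card J = card I"
    and nz: "\<And>a. a \<in> J \<Longrightarrow> (\<Sum>k\<in>I. (f a k)\<^sup>2) \<noteq> 0"
    and orth: "\<And>a b. a \<in> J \<Longrightarrow> b \<in> J \<Longrightarrow> a \<noteq> b \<Longrightarrow> (\<Sum>k\<in>I. f a k * f b k) = 0"
    and k: "k \<in> I" and l: "l \<in> I"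
  shows "(\<Sum>a\<in>J. f a k * f a l / (\<Sum>m\<in>I. (f a m)\<^sup>2)) = (if k = l then 1 else 0)"
proof -
  define n where "n a = (\<Sum>m\<in>I. (f a m)\<^sup>2)" for a
  define P where "P k l = (\<Sum>a\<in>J. f a k * f a l / n a)" for k l
  define E where "E k l = (if k = l then 1 else 0) - P k l" for k l
  \<comment> \<open>\<open>P\<close> is symmetric and idempotent, so a diagonal entry is the squared
    norm of its row.\<close>
  have PP: "(\<Sum>l\<in>I. (P k l)\<^sup>2) = P k k" for k
  proof -
    have "(\<Sum>l\<in>I. (P k l)\<^sup>2) =
        (\<Sum>l\<in>I. \<Sum>a\<in>J. \<Sum>b\<in>J. f a k * f b k / (n a * n b) * (f a l * f b l))"
      unfolding P_def power2_eq_square sum_product by (simp add: field_simps)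
    also have "\<dots> = (\<Sum>a\<in>J. \<Sum>b\<in>J. f a k * f b k / (n a * n b) * (\<Sum>l\<in>I. f a l * f b l))"
      by (simp only: sum_distrib_left sum.swap[of _ _ I])
    also have "\<dots> = (\<Sum>a\<in>J. \<Sum>b\<in>J. if b = a then f a k * f a k / n a else 0)"
    proof (intro sum.cong refl)
      fix a b assume ab: "a \<in> J" "b \<in> J"
      then show "f a k * f b k / (n a * n b) * (\<Sum>l\<in>I. f a l * f b l) =
          (if b = a then f a k * f a k / n a else 0)"
        using nz[of a] orth[of a b] by (auto simp: n_def power2_eq_square)
    qed
    also have "\<dots> = P k k"
      using fin by (simp add: P_def)
    finally show ?thesis .
  qed
  have EE: "(\<Sum>l\<in>I. (E k l)\<^sup>2) = 1 - P k k" if "k \<in> I" for k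
  proof -
    have "(\<Sum>l\<in>I. (E k l)\<^sup>2) = (\<Sum>l\<in>I. (if l = k then 1 - 2 * P k k else 0) + (P k l)\<^sup>2)"
      by (rule sum.cong) (auto simp: E_def power2_eq_square algebra_simps)
    also have "\<dots> = 1 - P k k"
      using that fin by (simp add: sum.distrib PP)
    finally show ?thesis .
  qed
  \<comment> \<open>The trace of the projection counts the functions.\<close>
  have "(\<Sum>k\<in>I. P k k) = (\<Sum>a\<in>J. (\<Sum>k\<in>I. (f a k)\<^sup>2) / n a)"
    unfolding P_def by (subst sum.swap) (simp add: sum_divide_distrib power2_eq_square)
  also have "\<dots> = (\<Sum>a\<in>J. 1)"
    using nz by (intro sum.cong) (auto simp: n_def)
  finally have "(\<Sum>k\<in>I. 1 - P k k) = 0"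
    by (simp add: sum_subtractf card)
  then have "(\<Sum>k\<in>I. \<Sum>l\<in>I. (E k l)\<^sup>2) = 0"
    by (simp add: EE cong: sum.cong)
  then have "(\<Sum>l\<in>I. (E k l)\<^sup>2) = 0"
    using k fin by (subst (asm) sum_nonneg_eq_0_iff) (auto intro: sum_nonneg)
  then have "(E k l)\<^sup>2 = 0"
    using l fin by (subst (asm) sum_nonneg_eq_0_iff) auto
  then show ?thesis
    by (simp add: E_def P_def n_def split: if_splits)
qed

text \<open>All values are plus or minus the same root, and an odd number of such terms cannot
  cancel unless the root is zero.\<close>

lemma odd_card_sum_zero:
  fixes f :: "'i \<Rightarrow> real"
  assumes odd: "odd (card J)" and sq: "\<And>k. k \<in> J \<Longrightarrow> (f k)\<^sup>2 = c"
    and sum: "(\<Sum>k\<in>J. f k) = 0"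
  shows "c = 0"
proof (rule ccontr)
  assume "c \<noteq> 0"
  have fin: "finite J" using odd by (metis card.infinite even_zero)
  let ?r = "sqrt c" and ?A = "{k \<in> J. f k = sqrt c}"
  have "J \<noteq> {}" using odd by auto
  then obtain k where "k \<in> J" by blast
  from sq[OF this] \<open>c \<noteq> 0\<close> have c: "c > 0" by (metis less_eq_real_def zero_le_power2)
  have f: "f k = ?r \<or> f k = - ?r" if "k \<in> J" for k
  proof -
    have "(f k)\<^sup>2 = ?r\<^sup>2" using sq[OF that] c by simp
    then show ?thesis by (simp add: power2_eq_iff)
  qed
  \<comment> \<open>Shifting by the root kills the negative terms and doubles the positive ones, so
    the sum counts the plus signs.\<close>
  have "(\<Sum>k\<in>J. f k + ?r) = (\<Sum>k\<in>J. if k \<in> ?A then 2 * ?r else 0)"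
  proof (rule sum.cong)
    fix k assume "k \<in> J"
    then show "f k + ?r = (if k \<in> ?A then 2 * ?r else 0)" using f[of k] by auto
  qed simp
  also have "\<dots> = 2 * ?r * card ?A"
    using fin by (simp add: sum.If_cases Int_def)
  finally have "?r * card J = ?r * (2 * card ?A)"
    using sum by (simp add: sum.distrib mult.commute)
  then have "real (card J) = real (2 * card ?A)"
    using c by simp
  then have "card J = 2 * card ?A"
    by (simp only: of_nat_eq_iff)
  then show False using odd by simp
qed

section \<open>Designs lying on a conic in diagonal form\<close>

context design_frame
begin

text \<open>If all \<open>x k\<close> vanished, both moments in \<open>moment_x4\<close> would be
  zero and only the multiple of the cardinality would remain.\<close>

lemma fourth_moment_pos: "(\<Sum>k\<in>I. (x k) ^ 4) > 0"
proof (rule ccontr)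
  assume neg: "\<not> ?thesis"
  have "(\<Sum>k\<in>I. (x k) ^ 4) \<ge> 0" by (intro sum_nonneg) simp
  with neg have 0: "(\<Sum>k\<in>I. (x k) ^ 4) = 0" by simp
  then have "\<forall>k\<in>I. x k = 0"
    using finite_I by (simp add: sum_nonneg_eq_0_iff)
  then have "(\<Sum>k\<in>I. (x k)\<^sup>2) = 0" "(\<Sum>k\<in>I. (x k)\<^sup>2 * (y k)\<^sup>2) = 0" "(\<Sum>k\<in>I. (z k)\<^sup>2 * (x k)\<^sup>2) = 0"
    by simp_all
  then have "real (card I) = 0"
    using moment_x4 0 by simp
  then show False using finite_I nonempty_I by simp
qed

text \<open>Multiply the conic by x^2 and sum. Each mixed moment is one sixth of the sum of two pure
  fourth moments, which makes the right-hand side invariant under rotation of the axes.\<close>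

lemma conic_square_relation:
  assumes "\<And>k. k \<in> I \<Longrightarrow> c1 * (x k)\<^sup>2 + c2 * (y k)\<^sup>2 + c3 * (z k)\<^sup>2 = 0"
  shows "(c1 + c2 + c3 + 4 * c1) * (\<Sum>k\<in>I. (x k) ^ 4) =
    - (c1 * (\<Sum>k\<in>I. (x k) ^ 4) + c2 * (\<Sum>k\<in>I. (y k) ^ 4) + c3 * (\<Sum>k\<in>I. (z k) ^ 4))"
proof -
  have "(\<Sum>k\<in>I. (x k)\<^sup>2 * (c1 * (x k)\<^sup>2 + c2 * (y k)\<^sup>2 + c3 * (z k)\<^sup>2)) = 0"
    by (simp add: assms)
  then have "c1 * (\<Sum>k\<in>I. (x k) ^ 4) + c2 * (\<Sum>k\<in>I. (x k)\<^sup>2 * (y k)\<^sup>2) + c3 * (\<Sum>k\<in>I. (z k)\<^sup>2 * (x k)\<^sup>2) = 0"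
    by (simp add: sum_distrib_left sum.distrib distrib_left power4_eq_xxxx power2_eq_square mult_ac)
  then show ?thesis
    using moment_x2y2 yzx.yzx.moment_x2y2 moment_x4 yzx.moment_x4 yzx.yzx.moment_x4 by algebra
qed

text \<open>Multiply the conic by x y and sum; the moments of x^3 y, x y^3 and z^2 x y are 3/7, 3/7
  and 1/7 of the moment of x y.\<close>

lemma conic_product_relation:
  assumes "\<And>k. k \<in> I \<Longrightarrow> c1 * (x k)\<^sup>2 + c2 * (y k)\<^sup>2 + c3 * (z k)\<^sup>2 = 0"
  shows "(3 * c1 + 3 * c2 + c3) * (\<Sum>k\<in>I. x k * y k) = 0"
proof -
  have "(\<Sum>k\<in>I. x k * y k * (c1 * (x k)\<^sup>2 + c2 * (y k)\<^sup>2 + c3 * (z k)\<^sup>2)) = 0"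
    by (simp add: assms)
  then have "c1 * (\<Sum>k\<in>I. (x k) ^ 3 * y k) + c2 * (\<Sum>k\<in>I. x k * (y k) ^ 3) + c3 * (\<Sum>k\<in>I. (z k)\<^sup>2 * (x k * y k)) = 0"
    by (simp add: sum_distrib_left sum.distrib distrib_left power3_eq_cube power2_eq_square mult_ac)
  then show ?thesis
    using moment_x3y moment_xy3 yzx.yzx.moment_x2yz by algebra
qed

end

context design_frame
begin

text \<open>The three rotated square relations share one right-hand side. Adding them determines it,
  because the three fourth moments sum to 3/5 of the cardinality.\<close>

lemma conic_trace_relation:
  assumes "\<And>k. k \<in> I \<Longrightarrow> c1 * (x k)\<^sup>2 + c2 * (y k)\<^sup>2 + c3 * (z k)\<^sup>2 = 0"
  shows "35 * ((c1 + c2 + c3 + 4 * c1) * (\<Sum>k\<in>I. (x k) ^ 4)) = 3 * real (card I) * (c1 + c2 + c3)"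
proof -
  have "c2 * (y k)\<^sup>2 + c3 * (z k)\<^sup>2 + c1 * (x k)\<^sup>2 = 0" "c3 * (z k)\<^sup>2 + c1 * (x k)\<^sup>2 + c2 * (y k)\<^sup>2 = 0"
    if "k \<in> I" for k
    using assms[OF that] by simp_all
  from yzx.conic_square_relation[OF this(1)] yzx.yzx.conic_square_relation[OF this(2)]
  show ?thesis
    using conic_square_relation[OF assms] moment_trace moment_x4 yzx.moment_x4 yzx.yzx.moment_x4
    by algebra
qed

lemma traceless_conic_coefficient:
  assumes "\<And>k. k \<in> I \<Longrightarrow> c1 * (x k)\<^sup>2 + c2 * (y k)\<^sup>2 + c3 * (z k)\<^sup>2 = 0" "c1 + c2 + c3 = 0"
  shows "c1 = 0"
  using conic_trace_relation[OF assms(1)] assms(2) fourth_moment_pos by simp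

end

text \<open>
  If the conic is \<open>c1 x^2 + c2 y^2 + c3 z^2 = 0\<close> and \<open>t = c1 + c2 + c3\<close>, then \<open>u = 1 + 4 c1 / t\<close>, and similarly for
  \<open>v\<close> and \<open>w\<close>; on the unit sphere the conic becomes \<open>u x^2 + v y^2 + w z^2 = 1\<close>.
\<close>

locale conic_frame = design_frame +
  fixes u v w :: real
  assumes card_I: "card I = 5"
    and u_moment: "u * (\<Sum>k\<in>I. (x k) ^ 4) = 3 / 7"
    and v_moment: "v * (\<Sum>k\<in>I. (y k) ^ 4) = 3 / 7"
    and w_moment: "w * (\<Sum>k\<in>I. (z k) ^ 4) = 3 / 7"
    and uvw_sum: "u + v + w = 7"
    and conic: "k \<in> I \<Longrightarrow> u * (x k)\<^sup>2 + v * (y k)\<^sup>2 + w * (z k)\<^sup>2 = 1"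
    and xy_sum: "(\<Sum>k\<in>I. x k * y k) = 0"
    and yz_sum: "(\<Sum>k\<in>I. y k * z k) = 0"
    and zx_sum: "(\<Sum>k\<in>I. z k * x k) = 0"
begin

lemma conic_frame_rotate: "conic_frame I y z x v w u"
proof (intro conic_frame.intro conic_frame_axioms.intro)
  show "v + w + u = 7" using uvw_sum by simp
  show "v * (y k)\<^sup>2 + w * (z k)\<^sup>2 + u * (x k)\<^sup>2 = 1" if "k \<in> I" for k
    using conic[OF that] by simp
qed (fact rotate card_I u_moment v_moment w_moment xy_sum yz_sum zx_sum)+

end

sublocale conic_frame \<subseteq> yzx: conic_frame I y z x v w u
  by (fact conic_frame_rotate)

section \<open>Moments and excluded positions in a conic frame\<close>

context conic_frame
begin

lemma u_pos: "u > 0"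
  using u_moment fourth_moment_pos
  by (metis zero_less_divide_iff zero_less_mult_pos2 zero_less_numeral)

lemma x4_eq: "(\<Sum>k\<in>I. (x k) ^ 4) = 3 / (7 * u)"
  using u_moment u_pos by (simp add: field_simps)

lemma x2_eq: "(\<Sum>k\<in>I. (x k)\<^sup>2) = (1 + 1 / u) / 2"
  using moment_x4 x4_eq u_pos by (simp add: card_I field_simps)

end

context conic_frame
begin

lemma x2y2_eq: "(\<Sum>k\<in>I. (x k)\<^sup>2 * (y k)\<^sup>2) = (u + v) / (14 * u * v)"
  using moment_x2y2 x2_eq yzx.x2_eq u_pos yzx.u_pos by (simp add: card_I field_simps)

text \<open>A point on the first axis would force u = 1, hence a total fourth moment of 3/7, while
  that point alone contributes 1.\<close>

lemma not_axis:
  assumes "k \<in> I" "y k = 0" "z k = 0"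
  shows False
proof -
  have x2: "(x k)\<^sup>2 = 1" using unit[OF assms(1)] assms by simp
  then have "(x k) ^ 4 = 1" using power_mult[of "x k" 2 2] by simp
  moreover from x2 have "u = 1" using conic[OF assms(1)] assms by simp
  moreover have "(x k) ^ 4 \<le> (\<Sum>k\<in>I. (x k) ^ 4)"
    using assms(1) finite_I by (intro member_le_sum) auto
  ultimately show False
    using x4_eq by simp
qed

end

context conic_frame
begin

text \<open>The products of coordinates have constant squares on \<open>J\<close>, so by parity all
  of them vanish. Then two coordinates vanish and the point lies on an axis.\<close>

lemma no_odd_constant_part:
  assumes "J \<subseteq> I" "odd (card J)"
    and "\<And>k. k \<in> J \<Longrightarrow> (x k)\<^sup>2 = a" "\<And>k. k \<in> J \<Longrightarrow> (y k)\<^sup>2 = b" "\<And>k. k \<in> J \<Longrightarrow> (z k)\<^sup>2 = c"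
    and "(\<Sum>k\<in>J. x k * y k) = 0" "(\<Sum>k\<in>J. y k * z k) = 0" "(\<Sum>k\<in>J. z k * x k) = 0"
  shows False
proof -
  have "a * b = 0" "b * c = 0" "c * a = 0"
    using odd_card_sum_zero[OF assms(2) _ assms(6), of "a * b"]
      odd_card_sum_zero[OF assms(2) _ assms(7), of "b * c"]
      odd_card_sum_zero[OF assms(2) _ assms(8), of "c * a"] assms(3-5)
    by (auto simp: power_mult_distrib)
  moreover obtain k where k: "k \<in> J" using assms(2) by fastforce
  ultimately have "y k = 0 \<and> z k = 0 \<or> z k = 0 \<and> x k = 0 \<or> x k = 0 \<and> y k = 0"
    using assms(3-5)[OF k] by auto
  then show False
    using k assms(1) not_axis yzx.not_axis yzx.yzx.not_axis by blast
qed

end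

subsection \<open>Three distinct parameters\<close>

text \<open>
  As \<open>u + v + w = 7\<close>, the sum below is, up to sign and a Vandermonde factor, a second divided difference at \<open>u, v, w\<close> of
  \<open>g s = (s^2 - 6 s + e2) / (7 - s) = - s - 1 + (7 + e2) / (7 - s)\<close> with \<open>e2 = u v + v w + w u\<close>.
\<close>

lemma linear_coefficient_nonzero:
  fixes u v w :: real
  assumes pos: "u > 0" "v > 0" "w > 0" and sum: "u + v + w = 7"
    and dist: "u \<noteq> v" "v \<noteq> w" "w \<noteq> u"
  shows "(v * w + u) * (v - w) / (v + w) + (w * u + v) * (w - u) / (w + u) + (u * v + w) * (u - v) / (u + v) \<noteq> 0"
    (is "?L \<noteq> 0")
proof
  have w: "w = 7 - u - v" using sum by simp
  assume "?L = 0"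
  moreover have "?L * ((v + w) * (w + u) * (u + v)) =
      (v * w + u) * (v - w) * (w + u) * (u + v) + (w * u + v) * (w - u) * (u + v) * (v + w)
      + (u * v + w) * (u - v) * (v + w) * (w + u)"
    using pos by (simp add: divide_simps add_pos_pos) algebra
  moreover have "\<dots> = - ((u - v) * (v - w) * (w - u) * (7 + (u * v + v * w + w * u)))"
    unfolding w by algebra
  ultimately have "(u - v) * (v - w) * (w - u) * (7 + (u * v + v * w + w * u)) = 0" by simp
  moreover have "7 + (u * v + v * w + w * u) > 0"
    using pos by (intro add_pos_pos mult_pos_pos) auto
  ultimately show False using dist by simp
qed

text \<open>The fractions over 10 are the means of y^2 and z^2, and 14 v w / (v + w) is the
  reciprocal of the moment of y^2 z^2. The lemma brings each part of the linear coefficient to the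
  form used in \<open>linear_coefficient_nonzero\<close>.\<close>

lemma linear_coefficient_term:
  fixes u v w :: real
  assumes "v > 0" "w > 0"
  shows "((1 + 1 / v) / 10 * (u - v) + (1 + 1 / w) / 10 * (w - u)) * (14 * v * w / (v + w))
    = - (7 / 5) * ((v * w + u) * (v - w) / (v + w))"
proof -
  have "((1 + 1 / v) / 10 * (u - v) + (1 + 1 / w) / 10 * (w - u)) * (14 * v * w)
      = - (7 / 5) * ((v * w + u) * (v - w))"
    using assms by (simp add: field_simps)
  then show ?thesis by (simp only: times_divide_eq_right)
qed

lemma quadratic_three_roots_linear_coefficient:
  fixes a b c :: real
  assumes "a * r\<^sup>2 + b * r + c = 0" "a * s\<^sup>2 + b * s + c = 0" "a * t\<^sup>2 + b * t + c = 0"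
    and "r \<noteq> s" "s \<noteq> t" "r \<noteq> t"
  shows "b = 0"
proof -
  have "(r - s) * (a * (r + s) + b) = 0" "(r - t) * (a * (r + t) + b) = 0"
    using assms(1-3) by algebra+
  then have *: "a * (r + s) + b = 0" "a * (r + t) + b = 0"
    using assms by auto
  then have "a * (s - t) = 0" by algebra
  then show "b = 0" using * assms by auto
qed

context conic_frame
begin

context
  assumes dist: "u \<noteq> v" "v \<noteq> w" "w \<noteq> u"
begin

text \<open>
  The coordinate of \<open>(x^2, y^2, z^2)\<close> on the line with direction \<open>(v - w, w - u, u - v)\<close>, measured from the
  mean of the five points.
\<close>

definition \<tau> :: "'a \<Rightarrow> real" where
  "\<tau> k = ((x k)\<^sup>2 - (1 + 1 / u) / 10) / (v - w)"

lemma inverse_sum: "1 / u + 1 / v + 1 / w = 7"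
  using moment_trace x2_eq yzx.x2_eq yzx.yzx.x2_eq by (simp add: card_I add_divide_distrib)

lemma x2_\<tau>: "(x k)\<^sup>2 = (1 + 1 / u) / 10 + \<tau> k * (v - w)"
  using dist by (simp add: \<tau>_def)

text \<open>The direction of the line is orthogonal to (1, 1, 1) and (u, v, w), and the mean point
  satisfies the sphere and conic equations because u, v, w and their reciprocals both sum to 7. So
  one square determines the other two.\<close>

lemma
  assumes "k \<in> I"
  shows y2_\<tau>: "(y k)\<^sup>2 = (1 + 1 / v) / 10 + \<tau> k * (w - u)"
    and z2_\<tau>: "(z k)\<^sup>2 = (1 + 1 / w) / 10 + \<tau> k * (u - v)"
proof -
  define m n p where m: "m = 1 / u" and n: "n = 1 / v" and p: "p = 1 / w"
  have i: "u * m = 1" "v * n = 1" "w * p = 1" "m + n + p = 7"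
    using u_pos yzx.u_pos yzx.yzx.u_pos inverse_sum by (auto simp: m n p)
  have a: "10 * (x k)\<^sup>2 = 1 + m + 10 * (\<tau> k * (v - w))"
    using x2_\<tau>[of k] by (simp add: m field_simps)
  have "(v - w) * (10 * (y k)\<^sup>2) = (v - w) * (1 + n + 10 * (\<tau> k * (w - u)))"
    "(v - w) * (10 * (z k)\<^sup>2) = (v - w) * (1 + p + 10 * (\<tau> k * (u - v)))"
    using unit[OF assms] conic[OF assms] uvw_sum i a by algebra+
  then have "10 * (y k)\<^sup>2 = 1 + n + 10 * (\<tau> k * (w - u))" "10 * (z k)\<^sup>2 = 1 + p + 10 * (\<tau> k * (u - v))"
    using dist by auto
  then show "(y k)\<^sup>2 = (1 + 1 / v) / 10 + \<tau> k * (w - u)" "(z k)\<^sup>2 = (1 + 1 / w) / 10 + \<tau> k * (u - v)"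
    unfolding n p by (simp_all add: add_divide_distrib)
qed

lemma \<tau>_sum: "(\<Sum>k\<in>I. \<tau> k) = 0"
proof -
  have "(\<Sum>k\<in>I. (x k)\<^sup>2) = (1 + 1 / u) / 2 + (\<Sum>k\<in>I. \<tau> k) * (v - w)"
    unfolding x2_\<tau> sum.distrib sum_distrib_right[symmetric] by (simp add: card_I)
  then show ?thesis using x2_eq dist by simp
qed

text \<open>\<tau> is an affine function of x^2.\<close>

lemma \<tau>_orthogonal:
  assumes "(\<Sum>k\<in>I. (x k)\<^sup>2 * g k) = 0" "(\<Sum>k\<in>I. g k) = 0"
  shows "(\<Sum>k\<in>I. g k * \<tau> k) = 0"
proof -
  have "(\<Sum>k\<in>I. g k * \<tau> k) = ((\<Sum>k\<in>I. (x k)\<^sup>2 * g k) - (1 + 1 / u) / 10 * (\<Sum>k\<in>I. g k)) / (v - w)"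
    unfolding sum_distrib_left sum_subtractf[symmetric] sum_divide_distrib \<tau>_def
    by (intro sum.cong) (auto simp: field_simps)
  then show ?thesis using assms by simp
qed

lemma
  shows \<tau>_yz: "(\<Sum>k\<in>I. y k * z k * \<tau> k) = 0"
    and \<tau>_zx: "(\<Sum>k\<in>I. z k * x k * \<tau> k) = 0"
    and \<tau>_xy: "(\<Sum>k\<in>I. x k * y k * \<tau> k) = 0"
proof -
  show "(\<Sum>k\<in>I. y k * z k * \<tau> k) = 0"
    using moment_x2yz yz_sum by (intro \<tau>_orthogonal) simp_all
  show "(\<Sum>k\<in>I. z k * x k * \<tau> k) = 0"
    using yzx.yzx.moment_xy3 zx_sum
    by (intro \<tau>_orthogonal) (simp_all add: power3_eq_cube power2_eq_square mult_ac)
  show "(\<Sum>k\<in>I. x k * y k * \<tau> k) = 0"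
    using moment_x3y xy_sum
    by (intro \<tau>_orthogonal) (simp_all add: power3_eq_cube power2_eq_square mult_ac)
qed

text \<open>On the five points, the functions y z, z x, x y, 1 and \<tau> are orthogonal, and
  nonzero if \<tau> is. This is a diagonal entry of the dual orthogonality relation.\<close>

lemma \<tau>_equation:
  assumes S: "(\<Sum>k\<in>I. (\<tau> k)\<^sup>2) \<noteq> 0" and k: "k \<in> I"
  shows "(y k)\<^sup>2 * (z k)\<^sup>2 * (14 * v * w / (v + w)) + (z k)\<^sup>2 * (x k)\<^sup>2 * (14 * w * u / (w + u))
    + (x k)\<^sup>2 * (y k)\<^sup>2 * (14 * u * v / (u + v)) + 1 / 5 + (\<tau> k)\<^sup>2 / (\<Sum>k\<in>I. (\<tau> k)\<^sup>2) = 1"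
proof -
  define f where "f a k = (if a = 0 then y k * z k else if a = 1 then z k * x k else
    if a = 2 then x k * y k else if a = 3 then 1 else \<tau> k)" for a :: nat and k
  have J: "{..<5::nat} = {0, 1, 2, 3, 4}" by auto
  have norms: "(\<Sum>k\<in>I. (y k * z k)\<^sup>2) = (v + w) / (14 * v * w)"
    "(\<Sum>k\<in>I. (z k * x k)\<^sup>2) = (w + u) / (14 * w * u)"
    "(\<Sum>k\<in>I. (x k * y k)\<^sup>2) = (u + v) / (14 * u * v)"
    using x2y2_eq yzx.x2y2_eq yzx.yzx.x2y2_eq by (simp_all add: power_mult_distrib)
  have orth: "(\<Sum>k\<in>I. y k * z k * (z k * x k)) = 0" "(\<Sum>k\<in>I. z k * x k * (x k * y k)) = 0"
    "(\<Sum>k\<in>I. y k * z k * (x k * y k)) = 0" "(\<Sum>k\<in>I. z k * x k * (y k * z k)) = 0"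
    "(\<Sum>k\<in>I. x k * y k * (z k * x k)) = 0" "(\<Sum>k\<in>I. x k * y k * (y k * z k)) = 0"
    using moment_x2yz yzx.moment_x2yz yzx.yzx.moment_x2yz xy_sum yz_sum zx_sum
    by (simp_all add: power2_eq_square mult_ac)
  have "(\<Sum>a\<in>{..<5::nat}. f a k * f a k / (\<Sum>m\<in>I. (f a m)\<^sup>2)) = (if k = k then 1 else 0)"
  proof (rule dual_orthogonality[OF finite_I _ _ _ _ k k])
    show "(\<Sum>k\<in>I. (f a k)\<^sup>2) \<noteq> 0" if "a \<in> {..<5}" for a
      using that S u_pos yzx.u_pos yzx.yzx.u_pos by (auto simp: J f_def norms card_I)
    show "(\<Sum>k\<in>I. f a k * f b k) = 0" if "a \<in> {..<5}" "b \<in> {..<5}" "a \<noteq> b" for a b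
      using that unfolding J
      by (auto simp: f_def orth xy_sum yz_sum zx_sum \<tau>_sum
          \<tau>_xy \<tau>_yz \<tau>_zx \<tau>_xy[unfolded mult.commute[of _ "\<tau> _"]]
          \<tau>_yz[unfolded mult.commute[of _ "\<tau> _"]] \<tau>_zx[unfolded mult.commute[of _ "\<tau> _"]])
  qed (auto simp: card_I)
  then have "(y k * z k)\<^sup>2 / (\<Sum>k\<in>I. (y k * z k)\<^sup>2) + (z k * x k)\<^sup>2 / (\<Sum>k\<in>I. (z k * x k)\<^sup>2)
      + (x k * y k)\<^sup>2 / (\<Sum>k\<in>I. (x k * y k)\<^sup>2) + 1 / 5 + (\<tau> k)\<^sup>2 / (\<Sum>k\<in>I. (\<tau> k)\<^sup>2) = 1"
    unfolding J by (simp add: f_def card_I flip: power2_eq_square)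
  then show ?thesis
    unfolding norms by (simp add: power_mult_distrib)
qed

lemma \<tau>_at_most_two_values:
  assumes "k \<in> I" "l \<in> I" "m \<in> I" and "\<tau> k \<noteq> \<tau> l" "\<tau> l \<noteq> \<tau> m" "\<tau> k \<noteq> \<tau> m"
  shows False
proof -
  define S where "S = (\<Sum>k\<in>I. (\<tau> k)\<^sup>2)"
  have "\<exists>k\<in>I. \<tau> k \<noteq> 0" using assms by metis
  then have "S \<noteq> 0"
    using finite_I by (auto simp: S_def sum_nonneg_eq_0_iff)
  define A B C where "A = 14 * v * w / (v + w)" and "B = 14 * w * u / (w + u)" and "C = 14 * u * v / (u + v)"
  define a b c i where "a = (1 + 1 / u) / 10" and "b = (1 + 1 / v) / 10" and "c = (1 + 1 / w) / 10" and "i = 1 / S"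
  \<comment> \<open>Inserting the affine expressions for the squares gives a quadratic equation in
    \<tau> whose coefficients are the same for every point.\<close>
  have q: "((w - u) * (u - v) * A + (u - v) * (v - w) * B + (v - w) * (w - u) * C + i) * (\<tau> k)\<^sup>2
     + ((b * (u - v) + c * (w - u)) * A + (c * (v - w) + a * (u - v)) * B + (a * (w - u) + b * (v - w)) * C) * \<tau> k
     + (b * c * A + c * a * B + a * b * C + 1 / 5 - 1) = 0" if "k \<in> I" for k
  proof -
    have "(y k)\<^sup>2 * (z k)\<^sup>2 * A + (z k)\<^sup>2 * (x k)\<^sup>2 * B + (x k)\<^sup>2 * (y k)\<^sup>2 * C + 1 / 5 + i * (\<tau> k)\<^sup>2 = 1"
      using \<tau>_equation[OF \<open>S \<noteq> 0\<close>[unfolded S_def] that] by (simp add: S_def A_def B_def C_def i_def)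
    moreover have "(x k)\<^sup>2 = a + \<tau> k * (v - w)" "(y k)\<^sup>2 = b + \<tau> k * (w - u)" "(z k)\<^sup>2 = c + \<tau> k * (u - v)"
      by (simp_all add: a_def b_def c_def x2_\<tau> y2_\<tau>[OF that] z2_\<tau>[OF that])
    ultimately show ?thesis by algebra
  qed
  have "(b * (u - v) + c * (w - u)) * A + (c * (v - w) + a * (u - v)) * B + (a * (w - u) + b * (v - w)) * C = 0"
    by (rule quadratic_three_roots_linear_coefficient[OF q[OF assms(1)] q[OF assms(2)] q[OF assms(3)] assms(4-6)])
  moreover have "(b * (u - v) + c * (w - u)) * A = - (7 / 5) * ((v * w + u) * (v - w) / (v + w))"
    "(c * (v - w) + a * (u - v)) * B = - (7 / 5) * ((w * u + v) * (w - u) / (w + u))"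
    "(a * (w - u) + b * (v - w)) * C = - (7 / 5) * ((u * v + w) * (u - v) / (u + v))"
    unfolding A_def B_def C_def a_def b_def c_def
    by (rule linear_coefficient_term[OF yzx.u_pos yzx.yzx.u_pos] linear_coefficient_term[OF yzx.yzx.u_pos u_pos]
        linear_coefficient_term[OF u_pos yzx.u_pos])+
  ultimately have "- (7 / 5) * ((v * w + u) * (v - w) / (v + w) + (w * u + v) * (w - u) / (w + u)
      + (u * v + w) * (u - v) / (u + v)) = 0"
    by (simp only: distrib_left)
  then show False
    using linear_coefficient_nonzero[OF u_pos yzx.u_pos yzx.yzx.u_pos uvw_sum dist] by simp
qed

text \<open>With two values, the indicator of a level set is affine in \<tau>, so orthogonality to 1
  and \<tau> passes to each level set.\<close>

lemma two_level_sums: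
  assumes two: "\<And>k. k \<in> I \<Longrightarrow> \<tau> k = a \<or> \<tau> k = b" and "a \<noteq> b"
    and "(\<Sum>k\<in>I. g k) = 0" "(\<Sum>k\<in>I. g k * \<tau> k) = 0"
  shows "(\<Sum>k\<in>{k\<in>I. \<tau> k = a}. g k) = 0"
proof -
  have "(a - b) * (\<Sum>k\<in>{k\<in>I. \<tau> k = a}. g k) = (\<Sum>k\<in>I. if \<tau> k = a then (a - b) * g k else 0)"
    using finite_I by (simp add: sum_distrib_left sum.inter_filter if_distrib cong: if_cong)
  also have "\<dots> = (\<Sum>k\<in>I. g k * \<tau> k - b * g k)"
  proof (rule sum.cong)
    fix k assume "k \<in> I"
    then show "(if \<tau> k = a then (a - b) * g k else 0) = g k * \<tau> k - b * g k"
      using two[of k] by (auto simp: algebra_simps)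
  qed simp
  also have "\<dots> = 0"
    using assms(3,4) by (simp add: sum_subtractf sum_distrib_left[symmetric])
  finally show ?thesis using \<open>a \<noteq> b\<close> by simp
qed

lemma no_odd_level:
  assumes "J \<subseteq> I" "odd (card J)" "\<And>k. k \<in> J \<Longrightarrow> \<tau> k = a"
    and "(\<Sum>k\<in>J. x k * y k) = 0" "(\<Sum>k\<in>J. y k * z k) = 0" "(\<Sum>k\<in>J. z k * x k) = 0"
  shows False
proof (rule no_odd_constant_part[OF assms(1,2) _ _ _ assms(4-6)])
  fix k assume k: "k \<in> J"
  then have "k \<in> I" using assms(1) by blast
  show "(x k)\<^sup>2 = (1 + 1 / u) / 10 + a * (v - w)" using x2_\<tau>[of k] assms(3)[OF k] by simp
  show "(y k)\<^sup>2 = (1 + 1 / v) / 10 + a * (w - u)" using y2_\<tau>[OF \<open>k \<in> I\<close>] assms(3)[OF k] by simp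
  show "(z k)\<^sup>2 = (1 + 1 / w) / 10 + a * (u - v)" using z2_\<tau>[OF \<open>k \<in> I\<close>] assms(3)[OF k] by simp
qed

text \<open>Five is odd, so one of the at most two level sets of \<tau> has odd size; on it all
  squared coordinates are constant.\<close>

lemma distinct_impossible: False
proof -
  obtain k where k: "k \<in> I" using nonempty_I by blast
  show False
  proof (cases "\<forall>l\<in>I. \<tau> l = \<tau> k")
    case True
    have "odd (card I)" by (simp add: card_I)
    then show False
      using True by (intro no_odd_level[OF subset_refl _ _ xy_sum yz_sum zx_sum, of "\<tau> k"]) blast+
  next
    case False
    then obtain l where l: "l \<in> I" "\<tau> l \<noteq> \<tau> k" by blast
    have two: "\<tau> m = \<tau> k \<or> \<tau> m = \<tau> l" if "m \<in> I" for m
      using \<tau>_at_most_two_values[OF k l(1) that] l(2) by force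
    let ?J = "{m\<in>I. \<tau> m = \<tau> k}" and ?K = "{m\<in>I. \<tau> m = \<tau> l}"
    have sums: "(\<Sum>k\<in>?J. g k) = 0" "(\<Sum>k\<in>?K. g k) = 0"
      if "(\<Sum>k\<in>I. g k) = 0" "(\<Sum>k\<in>I. g k * \<tau> k) = 0" for g
    proof -
      show "(\<Sum>k\<in>?J. g k) = 0"
        by (rule two_level_sums[OF _ l(2)[symmetric] that]) (rule two)
      show "(\<Sum>k\<in>?K. g k) = 0"
        by (rule two_level_sums[OF _ l(2) that]) (use two in blast)
    qed
    have "I = ?J \<union> ?K" using two by blast
    moreover have "card (?J \<union> ?K) = card ?J + card ?K"
      using finite_I l(2) by (intro card_Un_disjoint) auto
    ultimately have "card ?J + card ?K = 5" using card_I by simp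
    then have "odd (card ?J + card ?K)" by simp
    then have "odd (card ?J) \<or> odd (card ?K)" by (simp only: odd_add) blast
    then show False
    proof
      assume "odd (card ?J)"
      show False
        by (rule no_odd_level[OF _ \<open>odd (card ?J)\<close> _ sums(1)[OF xy_sum \<tau>_xy] sums(1)[OF yz_sum \<tau>_yz] sums(1)[OF zx_sum \<tau>_zx], of "\<tau> k"]) simp_all
    next
      assume "odd (card ?K)"
      show False
        by (rule no_odd_level[OF _ \<open>odd (card ?K)\<close> _ sums(2)[OF xy_sum \<tau>_xy] sums(2)[OF yz_sum \<tau>_yz] sums(2)[OF zx_sum \<tau>_zx], of "\<tau> l"]) simp_all
    qed
  qed
qed

end

lemma two_equal: "u = v \<or> v = w \<or> w = u"
  using distinct_impossible by blast

end

subsection \<open>Two equal parameters\<close>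

context conic_frame
begin

lemma two_equal_constant_height:
  assumes "v = w"
  obtains H where "35 * H\<^sup>2 - 30 * H + 3 = 0" "\<And>k. k \<in> I \<Longrightarrow> (x k)\<^sup>2 = H"
proof -
  define H where "H = (1 - v) / (u - v)"
  \<comment> \<open>If all three parameters were 7/3, the second moments would add up to 15/7 and
    not to 5.\<close>
  have uv: "u \<noteq> v"
  proof
    assume "u = v"
    then have eq: "u = 7 / 3" "v = 7 / 3" "w = 7 / 3" using assms uvw_sum by auto
    have "(1 + 1 / u) / 2 + (1 + 1 / v) / 2 + (1 + 1 / w) / 2 = 5"
      using moment_trace x2_eq yzx.x2_eq yzx.yzx.x2_eq by (simp add: card_I)
    then show False unfolding eq by simp
  qed
  have H: "(x k)\<^sup>2 = H" if "k \<in> I" for k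
  proof -
    have "(u - v) * (x k)\<^sup>2 = 1 - v"
      using conic[OF that] unit[OF that] assms by algebra
    then show ?thesis using uv by (simp add: H_def field_simps)
  qed
  \<comment> \<open>With constant height, the fourth moment identity involves \<open>H\<close>
    alone; it says that P_4 vanishes at the square root of \<open>H\<close>.\<close>
  have "(\<Sum>k\<in>I. (x k) ^ 4) = (\<Sum>k\<in>I. H\<^sup>2)"
    by (rule sum.cong) (auto simp flip: H)
  moreover have "(\<Sum>k\<in>I. (x k)\<^sup>2) = (\<Sum>k\<in>I. H)"
    by (rule sum.cong) (auto simp: H)
  ultimately have "5 * H\<^sup>2 = 6 / 7 * (5 * H) - 3 / 35 * 5"
    using moment_x4 by (simp add: card_I)
  then have "35 * H\<^sup>2 - 30 * H + 3 = 0" by algebra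
  then show thesis using H by (rule that)
qed

lemma two_equal_pentagon:
  assumes vw: "v = w"
  obtains H s where "35 * H\<^sup>2 - 30 * H + 3 = 0" "0 < H" "H < 1"
    "\<And>k. k \<in> I \<Longrightarrow> s k = 1 \<or> s k = -1" "\<And>k. k \<in> I \<Longrightarrow> x k = s k * sqrt H"
    "\<And>k. k \<in> I \<Longrightarrow> (y k)\<^sup>2 + (z k)\<^sup>2 = 1 - H"
    "\<And>k l. k \<in> I \<Longrightarrow> l \<in> I \<Longrightarrow> k \<noteq> l \<Longrightarrow>
      4 * (s k * s l * (y k * y l + z k * z l) / (1 - H))\<^sup>2 + 2 * (s k * s l * (y k * y l + z k * z l) / (1 - H)) - 1 = 0"
proof -
  obtain H where H: "35 * H\<^sup>2 - 30 * H + 3 = 0" and x2: "\<And>k. k \<in> I \<Longrightarrow> (x k)\<^sup>2 = H"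
    using two_equal_constant_height[OF vw] by blast
  have H_pos: "H > 0"
  proof -
    have "30 * H > 0" using H zero_le_power2[of H] by linarith
    then show ?thesis by simp
  qed
  have H_lt: "H < 1"
  proof (rule ccontr)
    assume "\<not> H < 1"
    then have "H * 1 \<le> H * H" using H_pos by (intro mult_left_mono) auto
    then show False using H \<open>\<not> H < 1\<close> unfolding power2_eq_square by linarith
  qed
  define R where "R = 1 - H"
  have R: "R > 0" using H_lt by (simp add: R_def)
  define s where "s k = x k / sqrt H" for k
  have s2: "(s k)\<^sup>2 = 1" if "k \<in> I" for k
    using x2[OF that] H_pos by (simp add: s_def power_divide)
  have x: "x k = s k * sqrt H" for k
    using H_pos by (simp add: s_def)
  have yz: "(y k)\<^sup>2 + (z k)\<^sup>2 = R" if "k \<in> I" for k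
    using unit[OF that] x2[OF that] by (simp add: R_def)
  have y2: "(\<Sum>k\<in>I. (y k)\<^sup>2) = 5 * R / 2" and z2: "(\<Sum>k\<in>I. (z k)\<^sup>2) = 5 * R / 2"
  proof -
    have "(\<Sum>k\<in>I. (y k)\<^sup>2) + (\<Sum>k\<in>I. (z k)\<^sup>2) = (\<Sum>k\<in>I. R)"
      unfolding sum.distrib[symmetric] by (rule sum.cong) (auto simp: yz)
    moreover have "(\<Sum>k\<in>I. (y k)\<^sup>2) = (\<Sum>k\<in>I. (z k)\<^sup>2)"
      using yzx.x2_eq yzx.yzx.x2_eq vw by simp
    ultimately show "(\<Sum>k\<in>I. (y k)\<^sup>2) = 5 * R / 2" "(\<Sum>k\<in>I. (z k)\<^sup>2) = 5 * R / 2"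
      by (simp_all add: card_I)
  qed
  have y2z2: "(\<Sum>k\<in>I. (y k)\<^sup>2 * (z k)\<^sup>2) = 5 * R\<^sup>2 / 8"
  proof -
    have "(\<Sum>k\<in>I. (y k) ^ 4) + (\<Sum>k\<in>I. (z k) ^ 4) + 2 * (\<Sum>k\<in>I. (y k)\<^sup>2 * (z k)\<^sup>2) = (\<Sum>k\<in>I. R\<^sup>2)"
      unfolding sum.distrib[symmetric] sum_distrib_left
      by (rule sum.cong) (auto simp flip: yz simp: power2_eq_square power4_eq_xxxx algebra_simps)
    then show ?thesis
      using yzx.moment_x4 yzx.yzx.moment_x4 yzx.moment_x2y2 y2 z2 by (simp add: card_I)
  qed
  have s_sum: "(\<Sum>k\<in>I. s k * g k) = 0" if "(\<Sum>k\<in>I. x k * g k) = 0" for g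
    using that by (simp add: s_def sum_divide_distrib[symmetric])
  \<comment> \<open>After multiplication by the sign \<open>s\<close>, the projections lie on a
    circle, and these are the harmonics 1, cos, sin, cos 2, sin 2 of the angle, up to scale.\<close>
  define f where "f a k = (if a = 0 then 1 else if a = 1 then s k * y k else
    if a = 2 then s k * z k else if a = 3 then (y k)\<^sup>2 - (z k)\<^sup>2 else y k * z k)" for a :: nat and k
  have J: "{..<5::nat} = {0, 1, 2, 3, 4}" by auto
  have norms: "(\<Sum>k\<in>I. (f 0 k)\<^sup>2) = 5" "(\<Sum>k\<in>I. (f 1 k)\<^sup>2) = 5 * R / 2" "(\<Sum>k\<in>I. (f 2 k)\<^sup>2) = 5 * R / 2"
    "(\<Sum>k\<in>I. (f 3 k)\<^sup>2) = 5 * R\<^sup>2 / 2" "(\<Sum>k\<in>I. (f 4 k)\<^sup>2) = 5 * R\<^sup>2 / 8"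
  proof -
    show "(\<Sum>k\<in>I. (f 0 k)\<^sup>2) = 5" by (simp add: f_def card_I)
    show "(\<Sum>k\<in>I. (f 1 k)\<^sup>2) = 5 * R / 2" "(\<Sum>k\<in>I. (f 2 k)\<^sup>2) = 5 * R / 2"
      using y2 z2 by (simp_all add: f_def power_mult_distrib s2 cong: sum.cong)
    show "(\<Sum>k\<in>I. (f 4 k)\<^sup>2) = 5 * R\<^sup>2 / 8"
      using y2z2 by (simp add: f_def power_mult_distrib)
    have "(\<Sum>k\<in>I. (f 3 k)\<^sup>2) = (\<Sum>k\<in>I. R\<^sup>2 - 4 * ((y k)\<^sup>2 * (z k)\<^sup>2))"
      by (rule sum.cong) (auto simp: f_def simp flip: yz simp: power2_eq_square algebra_simps)
    then show "(\<Sum>k\<in>I. (f 3 k)\<^sup>2) = 5 * R\<^sup>2 / 2"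
      by (simp add: sum_subtractf sum_distrib_left[symmetric] y2z2 card_I)
  qed
  have orth: "(\<Sum>k\<in>I. f a k * f b k) = 0" if "a < b" "b < 5" for a b
  proof -
    have 01: "(\<Sum>k\<in>I. f 0 k * f 1 k) = 0" "(\<Sum>k\<in>I. f 0 k * f 2 k) = 0"
      using xy_sum zx_sum by (auto simp: f_def mult.commute intro!: s_sum)
    have 03: "(\<Sum>k\<in>I. f 0 k * f 3 k) = 0" "(\<Sum>k\<in>I. f 0 k * f 4 k) = 0"
      using yz_sum y2 z2 by (simp_all add: f_def sum_subtractf)
    have "(\<Sum>k\<in>I. f 1 k * f 2 k) = (\<Sum>k\<in>I. y k * z k)"
      by (rule sum.cong) (use s2 in \<open>auto simp: f_def power2_eq_square\<close>)
    then have 12: "(\<Sum>k\<in>I. f 1 k * f 2 k) = 0" using yz_sum by simp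
    \<comment> \<open>The remaining inner products reduce to moments proportional to the vanishing
      sums of x y, y z and z x.\<close>
    have "(\<Sum>k\<in>I. x k * (y k * ((y k)\<^sup>2 - (z k)\<^sup>2))) = (\<Sum>k\<in>I. x k * (y k) ^ 3) - (\<Sum>k\<in>I. (z k)\<^sup>2 * (x k * y k))"
      unfolding sum_subtractf[symmetric] by (rule sum.cong) (auto simp: power2_eq_square power3_eq_cube algebra_simps)
    also have "\<dots> = 0" using moment_xy3 yzx.yzx.moment_x2yz xy_sum by simp
    finally have 13: "(\<Sum>k\<in>I. f 1 k * f 3 k) = 0"
      using s_sum by (simp add: f_def mult.assoc)
    have "(\<Sum>k\<in>I. x k * (z k * ((y k)\<^sup>2 - (z k)\<^sup>2))) = (\<Sum>k\<in>I. (y k)\<^sup>2 * (z k * x k)) - (\<Sum>k\<in>I. (z k) ^ 3 * x k)"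
      unfolding sum_subtractf[symmetric] by (rule sum.cong) (auto simp: power2_eq_square power3_eq_cube algebra_simps)
    also have "\<dots> = 0" using yzx.yzx.moment_x3y yzx.moment_x2yz zx_sum by simp
    finally have 23: "(\<Sum>k\<in>I. f 2 k * f 3 k) = 0"
      using s_sum by (simp add: f_def mult.assoc)
    have "(\<Sum>k\<in>I. x k * (y k * (y k * z k))) = (\<Sum>k\<in>I. (y k)\<^sup>2 * (z k * x k))"
      "(\<Sum>k\<in>I. x k * (z k * (y k * z k))) = (\<Sum>k\<in>I. (z k)\<^sup>2 * (x k * y k))"
      by (rule sum.cong; simp add: power2_eq_square)+
    then have 14: "(\<Sum>k\<in>I. f 1 k * f 4 k) = 0" "(\<Sum>k\<in>I. f 2 k * f 4 k) = 0"
      using s_sum yzx.moment_x2yz yzx.yzx.moment_x2yz xy_sum zx_sum by (simp_all add: f_def mult.assoc)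
    have "(\<Sum>k\<in>I. f 3 k * f 4 k) = (\<Sum>k\<in>I. (y k) ^ 3 * z k) - (\<Sum>k\<in>I. y k * (z k) ^ 3)"
      unfolding sum_subtractf[symmetric]
      by (rule sum.cong) (auto simp: f_def power2_eq_square power3_eq_cube algebra_simps)
    then have 34: "(\<Sum>k\<in>I. f 3 k * f 4 k) = 0"
      using yzx.moment_x3y yzx.moment_xy3 by simp
    have "a = 0 \<and> (b = 1 \<or> b = 2 \<or> b = 3 \<or> b = 4) \<or> a = 1 \<and> (b = 2 \<or> b = 3 \<or> b = 4)
        \<or> a = 2 \<and> (b = 3 \<or> b = 4) \<or> a = 3 \<and> b = 4" using that by arith
    then show ?thesis using 01 03 12 13 14 23 34 by blast
  qed
  show ?thesis
  proof (rule that[OF H H_pos H_lt _ x yz[unfolded R_def]])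
    show "s k = 1 \<or> s k = -1" if "k \<in> I" for k
      using s2[OF that] by (simp add: power2_eq_1_iff)
  next
    fix k l assume k: "k \<in> I" and l: "l \<in> I" and kl: "k \<noteq> l"
    have "(\<Sum>a\<in>{..<5::nat}. f a k * f a l / (\<Sum>m\<in>I. (f a m)\<^sup>2)) = (if k = l then 1 else 0)"
    proof (rule dual_orthogonality[OF finite_I _ _ _ _ k l])
      show "(\<Sum>k\<in>I. (f a k)\<^sup>2) \<noteq> 0" if "a \<in> {..<5}" for a
        using that R unfolding J by (elim insertE emptyE) (simp_all only: norms, simp_all)
      show "(\<Sum>k\<in>I. f a k * f b k) = 0" if "a \<in> {..<5}" "b \<in> {..<5}" "a \<noteq> b" for a b
        using that orth[of a b] orth[of b a] by (cases a b rule: linorder_cases) (auto simp: mult.commute)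
    qed (auto simp: card_I)
    then have "f 0 k * f 0 l / 5 + f 1 k * f 1 l / (5 * R / 2) + f 2 k * f 2 l / (5 * R / 2)
        + f 3 k * f 3 l / (5 * R\<^sup>2 / 2) + f 4 k * f 4 l / (5 * R\<^sup>2 / 8) = 0"
      unfolding J using kl by (simp add: norms add.assoc del: One_nat_def)
    then have E: "1 / 5 + s k * y k * (s l * y l) / (5 * R / 2) + s k * z k * (s l * z l) / (5 * R / 2)
        + ((y k)\<^sup>2 - (z k)\<^sup>2) * ((y l)\<^sup>2 - (z l)\<^sup>2) / (5 * R\<^sup>2 / 2) + y k * z k * (y l * z l) / (5 * R\<^sup>2 / 8) = 0"
      by (simp add: f_def)
    define i where "i = 1 / R"
    define a where "a = s k * s l * (y k * y l + z k * z l) / R"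
    have i: "i * R = 1" and a: "a = i * (s k * s l * (y k * y l + z k * z l))"
      using R by (simp_all add: i_def a_def)
    have E': "1 + 2 * i * (s k * y k * (s l * y l)) + 2 * i * (s k * z k * (s l * z l))
        + 2 * i\<^sup>2 * (((y k)\<^sup>2 - (z k)\<^sup>2) * ((y l)\<^sup>2 - (z l)\<^sup>2)) + 8 * i\<^sup>2 * (y k * z k * (y l * z l)) = 0"
      using E R by (simp add: i_def field_simps)
    \<comment> \<open>By the addition theorem the off-diagonal relation reads 1 + 2 cos + 2 cos 2 =
      0 at the angle between the two projections, with a = cos and cos 2 = 2 a^2 - 1.\<close>
    have "4 * a\<^sup>2 + 2 * a - 1 = 0"
      unfolding a using E' i s2[OF k] s2[OF l] yz[OF k] yz[OF l] by algebra
    then show "4 * (s k * s l * (y k * y l + z k * z l) / (1 - H))\<^sup>2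
        + 2 * (s k * s l * (y k * y l + z k * z l) / (1 - H)) - 1 = 0"
      by (simp add: a_def R_def)
  qed
qed

end

subsection \<open>The regular pentagon\<close>

text \<open>The fifth roots of unity in radicals: (sqrt 5 - 1) / 4 is the cosine of 72 degrees and -
  (sqrt 5 + 1) / 4 that of 144 degrees.\<close>

definition pentagon_dirs :: "(real \<times> real) set" where
  "pentagon_dirs = {(1, 0),
    ((sqrt 5 - 1) / 4, sqrt (10 + 2 * sqrt 5) / 4), (- (sqrt 5 + 1) / 4, sqrt (10 - 2 * sqrt 5) / 4),
    (- (sqrt 5 + 1) / 4, - sqrt (10 - 2 * sqrt 5) / 4), ((sqrt 5 - 1) / 4, - sqrt (10 + 2 * sqrt 5) / 4)}"

lemma sqrt_5_less: "sqrt 5 < 3"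
  by (rule real_less_lsqrt) auto

text \<open>The quadratic has the cosines of 72 and 144 degrees as roots, and each fixes the second
  coordinate up to sign. This turns the angle equation into membership in an explicit list.\<close>

lemma pentagon_dirs_iff:
  "(a, b) \<in> pentagon_dirs \<longleftrightarrow> a\<^sup>2 + b\<^sup>2 = 1 \<and> (a = 1 \<or> 4 * a\<^sup>2 + 2 * a - 1 = 0)"
proof -
  let ?p = "(sqrt 5 - 1) / 4" and ?q = "- (sqrt 5 + 1) / 4"
  have roots: "4 * a\<^sup>2 + 2 * a - 1 = 0 \<longleftrightarrow> a = ?p \<or> a = ?q"
  proof -
    have "4 * a\<^sup>2 + 2 * a - 1 = 4 * ((a - ?p) * (a - ?q))"
      by (simp add: field_simps power2_eq_square)
    then show ?thesis by simp
  qed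
  have p: "?p\<^sup>2 + b\<^sup>2 = 1 \<longleftrightarrow> b = sqrt (10 + 2 * sqrt 5) / 4 \<or> b = - sqrt (10 + 2 * sqrt 5) / 4"
  proof -
    have "?p\<^sup>2 + b\<^sup>2 = 1 \<longleftrightarrow> (b * 4)\<^sup>2 = (sqrt (10 + 2 * sqrt 5))\<^sup>2"
      by (auto simp: power2_eq_square field_simps)
    also have "\<dots> \<longleftrightarrow> b = sqrt (10 + 2 * sqrt 5) / 4 \<or> b = - sqrt (10 + 2 * sqrt 5) / 4"
      unfolding power2_eq_iff by (simp add: field_simps)
    finally show ?thesis .
  qed
  have q: "?q\<^sup>2 + b\<^sup>2 = 1 \<longleftrightarrow> b = sqrt (10 - 2 * sqrt 5) / 4 \<or> b = - sqrt (10 - 2 * sqrt 5) / 4"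
  proof -
    have "?q\<^sup>2 + b\<^sup>2 = 1 \<longleftrightarrow> (b * 4)\<^sup>2 = (sqrt (10 - 2 * sqrt 5))\<^sup>2"
      using sqrt_5_less by (auto simp: power2_eq_square field_simps)
    also have "\<dots> \<longleftrightarrow> b = sqrt (10 - 2 * sqrt 5) / 4 \<or> b = - sqrt (10 - 2 * sqrt 5) / 4"
      unfolding power2_eq_iff by (simp add: field_simps)
    finally show ?thesis .
  qed
  have sub: "a = t \<and> t\<^sup>2 + b\<^sup>2 = 1 \<longleftrightarrow> a\<^sup>2 + b\<^sup>2 = 1 \<and> a = t" for t by blast
  have one: "a = 1 \<and> b = 0 \<longleftrightarrow> a\<^sup>2 + b\<^sup>2 = 1 \<and> a = 1" by auto
  have "(a, b) \<in> pentagon_dirs \<longleftrightarrow> a = 1 \<and> b = 0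
      \<or> a = ?p \<and> (b = sqrt (10 + 2 * sqrt 5) / 4 \<or> b = - sqrt (10 + 2 * sqrt 5) / 4)
      \<or> a = ?q \<and> (b = sqrt (10 - 2 * sqrt 5) / 4 \<or> b = - sqrt (10 - 2 * sqrt 5) / 4)"
    unfolding pentagon_dirs_def by (simp only: insert_iff empty_iff prod.inject) blast
  also have "\<dots> \<longleftrightarrow> a\<^sup>2 + b\<^sup>2 = 1 \<and> (a = 1 \<or> a = ?p \<or> a = ?q)"
    unfolding p[symmetric] q[symmetric] sub one by blast
  finally show ?thesis by (simp only: roots)
qed

lemma card_pentagon_dirs: "card pentagon_dirs = 5"
proof -
  have "sqrt 5 > 0" by simp
  then have "10 + 2 * sqrt 5 > 0" "10 - 2 * sqrt 5 > 0" "- sqrt 5 - 1 \<noteq> sqrt 5 - 1"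
    "sqrt 5 - 1 \<noteq> 4" "- sqrt 5 - 1 \<noteq> 4" "- sqrt 5 \<noteq> 5" "sqrt 5 \<noteq> 5"
    using sqrt_5_less by linarith+
  then show ?thesis
    unfolding pentagon_dirs_def by (simp add: card_insert_if)
qed

definition pentagon_point :: "real \<Rightarrow> real \<times> real \<Rightarrow> real ^ 3" where
  "pentagon_point H d = vector [sqrt H, sqrt (1 - H) * fst d, sqrt (1 - H) * snd d]"

text \<open>Dividing the radicands by 35^2 exposes the squared height (15 + 2 e sqrt 30) / 35; for
  the two signs these are the roots of 35 H^2 - 30 H + 3.\<close>

lemma pentagon_eq:
  assumes e: "e = 1 \<or> e = -1"
  shows "pentagon e = pentagon_point ((15 + 2 * e * sqrt 30) / 35) ` pentagon_dirs"
proof -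
  let ?H = "(15 + 2 * e * sqrt 30) / 35"
  have "525 + e * (70 * sqrt 30) = 35\<^sup>2 * ?H" "700 - e * (70 * sqrt 30) = 35\<^sup>2 * (1 - ?H)"
    by (simp_all add: algebra_simps)
  then have h: "sqrt (525 + e * (70 * sqrt 30)) = 35 * sqrt ?H"
    and r: "sqrt (700 - e * (70 * sqrt 30)) = 35 * sqrt (1 - ?H)"
    by (simp_all only: real_sqrt_mult real_sqrt_abs abs_numeral)
  have c: "1 / 35 * (35 * R) = R" "t / 140 * (35 * R) = R * (t / 4)"
    "- (t / 140) * (35 * R) = R * (- t / 4)" for t R :: real
    by simp_all
  show ?thesis
    unfolding pentagon_def Let_def h r pentagon_dirs_def pentagon_point_def c image_insert image_empty
      fst_conv snd_conv mult_1_right mult_zero_right ..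
qed

lemma pentagon_point_inj:
  assumes "H < 1"
  shows "inj (pentagon_point H)"
proof (rule injI)
  fix c d assume eq: "pentagon_point H c = pentagon_point H d"
  have "pentagon_point H c $ 2 = pentagon_point H d $ 2" "pentagon_point H c $ 3 = pentagon_point H d $ 3"
    by (simp_all only: eq)
  then show "c = d" using assms by (simp add: pentagon_point_def prod_eq_iff)
qed

lemma orthogonal_transformation_frame:
  fixes e1 e2 e3 :: "real ^ 3"
  assumes "norm e1 = 1" "norm e2 = 1" "norm e3 = 1" "e1 \<bullet> e2 = 0" "e1 \<bullet> e3 = 0" "e2 \<bullet> e3 = 0"
  shows "orthogonal_transformation (\<lambda>p. vector [p \<bullet> e1, p \<bullet> e2, p \<bullet> e3] :: real ^ 3)"
    (is "orthogonal_transformation ?g")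
proof -
  have "linear ?g"
    by (rule linearI) (simp_all add: vec_eq_iff forall_3 inner_add_left)
  moreover have "?g v \<bullet> ?g w = v \<bullet> w" for v w
  proof -
    have "v \<bullet> w = ((v \<bullet> e1) *\<^sub>R e1 + (v \<bullet> e2) *\<^sub>R e2 + (v \<bullet> e3) *\<^sub>R e3) \<bullet> w"
      using orthonormal_frame_expansion[OF assms, of v] by simp
    then show ?thesis
      unfolding inner_vec_def[of "?g v"] sum_3 by (simp add: inner_add_left inner_add_right inner_commute)
  qed
  ultimately show ?thesis by (simp add: orthogonal_transformation_def)
qed

text \<open>Equal cardinalities make \<open>m\<close> a bijection onto \<open>X0\<close>; the points
  to replace are the images of those where \<open>g\<close> and \<open>m\<close> differ.\<close>

lemma signed_injection_antipodal:
  fixes g m :: "real ^ 'n \<Rightarrow> real ^ 'n"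
  assumes g: "orthogonal_transformation g" and X: "finite X" "card X = card X0" "finite X0"
    and inj: "inj_on m X" and m: "\<And>p. p \<in> X \<Longrightarrow> m p \<in> X0"
    and s: "\<And>p. p \<in> X \<Longrightarrow> g p = m p \<or> g p = - m p"
  shows "\<exists>Y. antipodal_replacement X0 Y \<and> congruent_sets X Y"
proof (intro exI conjI)
  show "congruent_sets X (g ` X)"
    using g by (auto simp: congruent_sets_def)
  let ?N = "{p \<in> X. g p \<noteq> m p}"
  have X0: "X0 = m ` X"
    using X m inj by (intro card_subset_eq[symmetric]) (auto simp: card_image)
  have "g ` X = g ` (X - ?N) \<union> g ` ?N" by blast
  also have "g ` (X - ?N) = m ` (X - ?N)" by (intro image_cong) auto
  also have "\<dots> = X0 - m ` ?N" unfolding X0 using inj by (intro inj_on_image_set_diff) auto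
  also have "g ` ?N = uminus ` m ` ?N" unfolding image_image using s by (intro image_cong) auto
  finally show "antipodal_replacement X0 (g ` X)"
    unfolding antipodal_replacement_def X0 by (intro exI[of _ "m ` ?N"]) auto
qed

text \<open>Turn the frame about \<open>e1\<close> until one point projects, up to sign, to
  direction (1, 0). The angle equation with that point puts every other direction into the
  pentagon.\<close>

lemma two_equal_frame_congruent:
  fixes X :: "(real ^ 3) set"
  assumes e: "norm e1 = 1" "norm e2 = 1" "norm e3 = 1" "e1 \<bullet> e2 = 0" "e1 \<bullet> e3 = 0" "e2 \<bullet> e3 = 0"
    and fr: "conic_frame X (\<lambda>p. p \<bullet> e1) (\<lambda>p. p \<bullet> e2) (\<lambda>p. p \<bullet> e3) u v v"
  shows "\<exists>X0\<in>{X0_plus, X0_minus}. \<exists>Y. antipodal_replacement X0 Y \<and> congruent_sets X Y"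
proof -
  interpret conic_frame X "\<lambda>p. p \<bullet> e1" "\<lambda>p. p \<bullet> e2" "\<lambda>p. p \<bullet> e3" u v v by (fact fr)
  obtain H s where H: "35 * H\<^sup>2 - 30 * H + 3 = 0" "0 < H" "H < 1"
    and s: "\<And>k. k \<in> X \<Longrightarrow> s k = 1 \<or> s k = -1" and x: "\<And>k. k \<in> X \<Longrightarrow> k \<bullet> e1 = s k * sqrt H"
    and yz: "\<And>k. k \<in> X \<Longrightarrow> (k \<bullet> e2)\<^sup>2 + (k \<bullet> e3)\<^sup>2 = 1 - H"
    and angle: "\<And>k l. k \<in> X \<Longrightarrow> l \<in> X \<Longrightarrow> k \<noteq> l \<Longrightarrow>
      4 * (s k * s l * (k \<bullet> e2 * (l \<bullet> e2) + k \<bullet> e3 * (l \<bullet> e3)) / (1 - H))\<^sup>2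
      + 2 * (s k * s l * (k \<bullet> e2 * (l \<bullet> e2) + k \<bullet> e3 * (l \<bullet> e3)) / (1 - H)) - 1 = 0"
    using two_equal_pentagon[OF refl] by blast
  have "(35 * H - 15 - 2 * sqrt 30) * (35 * H - 15 + 2 * sqrt 30) = 0"
    using H(1) by (simp add: algebra_simps power2_eq_square)
  then have "35 * H - 15 - 2 * sqrt 30 = 0 \<or> 35 * H - 15 + 2 * sqrt 30 = 0"
    by (simp only: mult_eq_0_iff)
  then have "H = (15 + 2 * 1 * sqrt 30) / 35 \<or> H = (15 + 2 * (-1) * sqrt 30) / 35"
    by (auto simp: field_simps)
  then obtain e where e': "e = 1 \<or> e = -1" and He: "H = (15 + 2 * e * sqrt 30) / 35"
    by blast
  define \<rho> where "\<rho> = sqrt (1 - H)"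
  have \<rho>: "\<rho> > 0" "\<rho>\<^sup>2 = 1 - H" using H by (simp_all add: \<rho>_def)
  obtain q\<^sub>0 where q0: "q\<^sub>0 \<in> X" using nonempty_I by blast
  \<comment> \<open>(c, d) is the unit direction of the chosen point's projection after its sign
    change, and \<open>f2\<close>, \<open>f3\<close> are the plane axes rotated accordingly.\<close>
  define c d where "c = s q\<^sub>0 * (q\<^sub>0 \<bullet> e2) / \<rho>" and "d = s q\<^sub>0 * (q\<^sub>0 \<bullet> e3) / \<rho>"
  have cd: "c\<^sup>2 + d\<^sup>2 = 1"
  proof -
    have "c\<^sup>2 + d\<^sup>2 = (s q\<^sub>0)\<^sup>2 * ((q\<^sub>0 \<bullet> e2)\<^sup>2 + (q\<^sub>0 \<bullet> e3)\<^sup>2) / \<rho>\<^sup>2"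
      by (simp add: c_def d_def power_mult_distrib power_divide distrib_left add_divide_distrib)
    then show ?thesis using s[OF q0] yz[OF q0] \<rho> by auto
  qed
  define f2 f3 where "f2 = c *\<^sub>R e2 + d *\<^sub>R e3" and "f3 = c *\<^sub>R e3 - d *\<^sub>R e2"
  define g where "g p = (vector [p \<bullet> e1, p \<bullet> f2, p \<bullet> f3] :: real ^ 3)" for p
  have g: "orthogonal_transformation g"
    unfolding g_def
  proof (rule orthogonal_transformation_frame[OF e(1)])
    have ee: "e2 \<bullet> e2 = 1" "e3 \<bullet> e3 = 1" using e by (simp_all add: norm_eq_1)
    show "norm f2 = 1" "norm f3 = 1" "e1 \<bullet> f2 = 0" "e1 \<bullet> f3 = 0" "f2 \<bullet> f3 = 0"
      using cd e ee by (simp_all add: norm_eq_1 f2_def f3_def inner_add_left inner_add_right inner_diff_left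
          inner_diff_right inner_commute power2_eq_square algebra_simps)
  qed
  define a b where "a p = s p * (p \<bullet> f2) / \<rho>" and "b p = s p * (p \<bullet> f3) / \<rho>" for p
  define m where "m p = pentagon_point H (a p, b p)" for p
  have gm: "g p = s p *\<^sub>R m p" if "p \<in> X" for p
  proof -
    have "s p * s p = 1" using s[OF that] by auto
    then show ?thesis
      using \<rho> x[OF that]
      by (simp add: vec_eq_iff forall_3 g_def m_def pentagon_point_def a_def b_def flip: \<rho>_def mult.assoc)
  qed
  have a_eq: "a p = s p * s q\<^sub>0 * (p \<bullet> e2 * (q\<^sub>0 \<bullet> e2) + p \<bullet> e3 * (q\<^sub>0 \<bullet> e3)) / (1 - H)" for p
    unfolding \<rho>(2)[symmetric]
    using \<rho>(1) by (simp add: a_def c_def d_def f2_def inner_add_right power2_eq_square field_simps)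
  have ab: "(a p)\<^sup>2 + (b p)\<^sup>2 = 1" if "p \<in> X" for p
  proof -
    have "(a p)\<^sup>2 + (b p)\<^sup>2 = (s p)\<^sup>2 * ((p \<bullet> f2)\<^sup>2 + (p \<bullet> f3)\<^sup>2) / \<rho>\<^sup>2"
      by (simp add: a_def b_def power_mult_distrib power_divide distrib_left add_divide_distrib)
    also have "(p \<bullet> f2)\<^sup>2 + (p \<bullet> f3)\<^sup>2 = (c\<^sup>2 + d\<^sup>2) * ((p \<bullet> e2)\<^sup>2 + (p \<bullet> e3)\<^sup>2)"
      by (simp add: f2_def f3_def inner_add_right inner_diff_right power2_eq_square algebra_simps)
    also have "(s p)\<^sup>2 * \<dots> / \<rho>\<^sup>2 = 1"
      using s[OF that] yz[OF that] \<rho> cd by auto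
    finally show ?thesis .
  qed
  have "a q\<^sub>0 = 1"
    using s[OF q0] yz[OF q0] H unfolding a_eq by (auto simp: power2_eq_square)
  then have dirs: "(a p, b p) \<in> pentagon_dirs" if "p \<in> X" for p
    using ab[OF that] angle[OF that q0] unfolding pentagon_dirs_iff a_eq by metis
  \<comment> \<open>Two points with equal directions would have cosine 1, which is not a root of the
    angle equation.\<close>
  have inj: "inj_on (\<lambda>p. (a p, b p)) X"
  proof (rule inj_onI, rule ccontr)
    fix p q assume pq: "p \<in> X" "q \<in> X" "(a p, b p) = (a q, b q)" "p \<noteq> q"
    have "s p * s q * (p \<bullet> e2 * (q \<bullet> e2) + p \<bullet> e3 * (q \<bullet> e3))
        = (c\<^sup>2 + d\<^sup>2) * (s p * s q * (p \<bullet> e2 * (q \<bullet> e2) + p \<bullet> e3 * (q \<bullet> e3)))"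
      using cd by simp
    also have "\<dots> = (s p * (p \<bullet> f2)) * (s q * (q \<bullet> f2)) + (s p * (p \<bullet> f3)) * (s q * (q \<bullet> f3))"
      by (simp add: f2_def f3_def inner_add_right inner_diff_right power2_eq_square algebra_simps)
    also have "\<dots> = \<rho>\<^sup>2 * (a p * a q + b p * b q)"
      using \<rho> by (simp add: a_def b_def power2_eq_square algebra_simps)
    also have "\<dots> = 1 - H"
      using ab[OF pq(2)] pq(3) \<rho>(2) by (simp add: power2_eq_square)
    finally show False
      using angle[OF pq(1,2,4)] H by simp
  qed
  have X0: "pentagon e = pentagon_point H ` pentagon_dirs"
    unfolding He by (rule pentagon_eq[OF e'])
  have "\<exists>Y. antipodal_replacement (pentagon e) Y \<and> congruent_sets X Y"
  proof (rule signed_injection_antipodal[OF g finite_I])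
    show "card X = card (pentagon e)"
      unfolding X0 using card_I card_pentagon_dirs pentagon_point_inj[OF H(3)]
      by (simp add: card_image inj_on_subset)
    show "finite (pentagon e)"
      unfolding X0 pentagon_dirs_def by simp
    show "inj_on m X"
      using inj pentagon_point_inj[OF H(3)] by (auto simp: m_def inj_on_def inj_def)
    show "m p \<in> pentagon e" if "p \<in> X" for p
      using dirs[OF that] by (simp add: X0 m_def)
    show "g p = m p \<or> g p = - m p" if "p \<in> X" for p
      using gm[OF that] s[OF that] by auto
  qed
  then show ?thesis using e' by (auto simp: X0_plus_def X0_minus_def)
qed

subsection \<open>The conic through the points\<close>

type_synonym real6 = "real \<times> real \<times> real \<times> real \<times> real \<times> real"

text \<open>The factors 2 make the inner product with \<open>c\<close> the value of the symmetric
  matrix with diagonal and off-diagonal entries \<open>c\<close>.\<close>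

definition veronese :: "real ^ 3 \<Rightarrow> real6" where
  "veronese x = ((x $ 1)\<^sup>2, (x $ 2)\<^sup>2, (x $ 3)\<^sup>2, 2 * x $ 1 * x $ 2, 2 * x $ 1 * x $ 3, 2 * x $ 2 * x $ 3)"

lemma conic_through_points:
  fixes V :: "real6 set"
  assumes "finite V" "card V \<le> 5"
  obtains c where "c \<noteq> 0" "\<And>v. v \<in> V \<Longrightarrow> c \<bullet> v = 0"
proof -
  have "dim V < DIM(real6)"
    using dim_le_card'[OF assms(1)] assms(2) by simp
  then obtain c where "c \<noteq> 0" "\<And>y. y \<in> span V \<Longrightarrow> orthogonal c y"
    using orthogonal_to_subspace_exists by blast
  then show ?thesis
    using that by (auto simp: orthogonal_def span_base)
qed

lemma conic_diagonal:
  assumes "c \<noteq> 0"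
  obtains e1 e2 e3 :: "real ^ 3" and c1 c2 c3 where
    "norm e1 = 1" "norm e2 = 1" "norm e3 = 1" "e1 \<bullet> e2 = 0" "e1 \<bullet> e3 = 0" "e2 \<bullet> e3 = 0"
    "\<And>x. c \<bullet> veronese x = c1 * (x \<bullet> e1)\<^sup>2 + c2 * (x \<bullet> e2)\<^sup>2 + c3 * (x \<bullet> e3)\<^sup>2"
    "c1 + c2 + c3 = c \<bullet> (1, 1, 1, 0, 0, 0)" "\<not> (c1 = 0 \<and> c2 = 0 \<and> c3 = 0)"
proof -
  obtain p q r l m n where c: "c = (p, q, r, l, m, n)" by (cases c)
  define \<beta> where "\<beta> x y = p * (x $ 1 * y $ 1) + q * (x $ 2 * y $ 2) + r * (x $ 3 * y $ 3)
      + l * (x $ 1 * y $ 2 + x $ 2 * y $ 1) + m * (x $ 1 * y $ 3 + x $ 3 * y $ 1)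
      + n * (x $ 2 * y $ 3 + x $ 3 * y $ 2)" for x y :: "real ^ 3"
  have "bilinear \<beta>"
    unfolding bilinear_def by (auto intro!: linearI simp: \<beta>_def algebra_simps)
  moreover have "\<beta> x y = \<beta> y x" for x y
    by (simp add: \<beta>_def algebra_simps)
  ultimately obtain e1 e2 e3 :: "real ^ 3" and c1 c2 c3 where
    e: "norm e1 = 1" "norm e2 = 1" "norm e3 = 1" "e1 \<bullet> e2 = 0" "e1 \<bullet> e3 = 0" "e2 \<bullet> e3 = 0"
    and \<beta>: "\<And>x. \<beta> x x = c1 * (x \<bullet> e1)\<^sup>2 + c2 * (x \<bullet> e2)\<^sup>2 + c3 * (x \<bullet> e3)\<^sup>2"
    using quadratic_form_diagonal by blast
  have v: "c \<bullet> veronese x = \<beta> x x" for x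
    by (simp add: c veronese_def \<beta>_def power2_eq_square algebra_simps)
  have sq: "(e $ 1)\<^sup>2 + (e $ 2)\<^sup>2 + (e $ 3)\<^sup>2 = 1" if "norm e = 1" for e :: "real ^ 3"
    using that by (simp add: norm_eq_1 inner_vec_def sum_3 power2_eq_square)
  \<comment> \<open>The trace is evaluated on the standard basis and equals the sum of the diagonal
    coefficients because the frame vectors are unit vectors.\<close>
  have "p + q + r = (\<Sum>i\<in>UNIV. \<beta> (axis i 1) (axis i 1))"
    by (simp add: sum_3 \<beta>_def axis_def)
  also have "\<dots> = c1 * ((e1 $ 1)\<^sup>2 + (e1 $ 2)\<^sup>2 + (e1 $ 3)\<^sup>2) + c2 * ((e2 $ 1)\<^sup>2 + (e2 $ 2)\<^sup>2 + (e2 $ 3)\<^sup>2)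
      + c3 * ((e3 $ 1)\<^sup>2 + (e3 $ 2)\<^sup>2 + (e3 $ 3)\<^sup>2)"
    unfolding \<beta> by (simp add: sum_3 inner_axis' algebra_simps)
  also have "\<dots> = c1 + c2 + c3"
    using sq e by simp
  finally have tr: "c1 + c2 + c3 = c \<bullet> (1, 1, 1, 0, 0, 0)"
    by (simp add: c)
  have "\<not> (c1 = 0 \<and> c2 = 0 \<and> c3 = 0)"
  proof
    assume "c1 = 0 \<and> c2 = 0 \<and> c3 = 0"
    then have z: "\<beta> x x = 0" for x using \<beta> by simp
    have "p = 0" "q = 0" "r = 0"
      using z[of "axis 1 1"] z[of "axis 2 1"] z[of "axis 3 1"] by (simp_all add: \<beta>_def axis_def)
    moreover from this have "l = 0" "m = 0" "n = 0"
      using z[of "vector [1, 1, 0]"] z[of "vector [1, 0, 1]"] z[of "vector [0, 1, 1]"]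
      by (simp_all add: \<beta>_def)
    ultimately show False using assms by (simp add: c zero_prod_def)
  qed
  with e tr \<beta> show ?thesis
    by (intro that) (simp_all add: v)
qed

lemma design_frame_of_design:
  fixes X :: "(real ^ 3) set"
  assumes D: "harmonic_index_design 4 X"
    and e: "norm e1 = 1" "norm e2 = 1" "norm e3 = 1" "e1 \<bullet> e2 = 0" "e1 \<bullet> e3 = 0" "e2 \<bullet> e3 = 0"
  shows "design_frame X (\<lambda>p. p \<bullet> e1) (\<lambda>p. p \<bullet> e2) (\<lambda>p. p \<bullet> e3)"
proof
  show "finite X" "X \<noteq> {}" using D by (simp_all add: harmonic_index_design_def)
  show "(p \<bullet> e1)\<^sup>2 + (p \<bullet> e2)\<^sup>2 + (p \<bullet> e3)\<^sup>2 = 1" if "p \<in> X" for p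
  proof -
    have "p \<bullet> p = 1" using that D by (auto simp: harmonic_index_design_def norm_eq_1)
    moreover have "p \<bullet> p = p \<bullet> ((p \<bullet> e1) *\<^sub>R e1 + (p \<bullet> e2) *\<^sub>R e2 + (p \<bullet> e3) *\<^sub>R e3)"
      using orthonormal_frame_expansion[OF e, of p] by simp
    ultimately show ?thesis
      by (simp add: inner_add_right power2_eq_square)
  qed
  fix \<alpha> \<beta> \<gamma> :: real
  let ?y = "\<alpha> *\<^sub>R e1 + \<beta> *\<^sub>R e2 + \<gamma> *\<^sub>R e3"
  have "e1 \<bullet> e1 = 1" "e2 \<bullet> e2 = 1" "e3 \<bullet> e3 = 1" "e2 \<bullet> e1 = 0" "e3 \<bullet> e1 = 0" "e3 \<bullet> e2 = 0"
    using e by (simp_all add: norm_eq_1 inner_commute)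
  then have "?y \<bullet> ?y = \<alpha>\<^sup>2 + \<beta>\<^sup>2 + \<gamma>\<^sup>2"
    using e(4-6) by (simp add: inner_add_left inner_add_right power2_eq_square)
  moreover have "p \<bullet> ?y = \<alpha> * (p \<bullet> e1) + \<beta> * (p \<bullet> e2) + \<gamma> * (p \<bullet> e3)" for p
    by (simp add: inner_add_right)
  ultimately show "(\<Sum>p\<in>X. (\<alpha> * (p \<bullet> e1) + \<beta> * (p \<bullet> e2) + \<gamma> * (p \<bullet> e3)) ^ 4
      - 6 / 7 * (\<alpha> * (p \<bullet> e1) + \<beta> * (p \<bullet> e2) + \<gamma> * (p \<bullet> e3))\<^sup>2 * (\<alpha>\<^sup>2 + \<beta>\<^sup>2 + \<gamma>\<^sup>2)
      + 3 / 35 * (\<alpha>\<^sup>2 + \<beta>\<^sup>2 + \<gamma>\<^sup>2)\<^sup>2) = 0"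
    using design_zonal_sum[OF D, of ?y] by simp
qed

lemma design_conic_trace:
  fixes X :: "(real ^ 3) set"
  assumes D: "harmonic_index_design 4 X" and c: "c \<noteq> 0" "\<And>p. p \<in> X \<Longrightarrow> c \<bullet> veronese p = 0"
  shows "c \<bullet> (1, 1, 1, 0, 0, 0) \<noteq> 0"
proof
  assume tr: "c \<bullet> (1, 1, 1, 0, 0, 0) = 0"
  obtain e1 e2 e3 :: "real ^ 3" and c1 c2 c3 where
    e: "norm e1 = 1" "norm e2 = 1" "norm e3 = 1" "e1 \<bullet> e2 = 0" "e1 \<bullet> e3 = 0" "e2 \<bullet> e3 = 0"
    and v: "\<And>x. c \<bullet> veronese x = c1 * (x \<bullet> e1)\<^sup>2 + c2 * (x \<bullet> e2)\<^sup>2 + c3 * (x \<bullet> e3)\<^sup>2"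
    and t: "c1 + c2 + c3 = c \<bullet> (1, 1, 1, 0, 0, 0)" and nz: "\<not> (c1 = 0 \<and> c2 = 0 \<and> c3 = 0)"
    using conic_diagonal[OF c(1)] by blast
  interpret design_frame X "\<lambda>p. p \<bullet> e1" "\<lambda>p. p \<bullet> e2" "\<lambda>p. p \<bullet> e3"
    by (rule design_frame_of_design[OF D e])
  have conic: "c1 * (p \<bullet> e1)\<^sup>2 + c2 * (p \<bullet> e2)\<^sup>2 + c3 * (p \<bullet> e3)\<^sup>2 = 0" if "p \<in> X" for p
    using c(2)[OF that] v by simp
  have "c1 = 0"
    by (rule traceless_conic_coefficient[of c1 c2 c3]) (use conic t tr in auto)
  moreover have "c2 = 0"
    by (rule yzx.traceless_conic_coefficient[of c2 c3 c1]) (use conic t tr in \<open>auto simp: algebra_simps\<close>)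
  moreover have "c3 = 0"
    by (rule yzx.yzx.traceless_conic_coefficient[of c3 c1 c2]) (use conic t tr in \<open>auto simp: algebra_simps\<close>)
  ultimately show False using nz by simp
qed

lemma design_card_ge_5:
  fixes X :: "(real ^ 3) set"
  assumes D: "harmonic_index_design 4 X"
  shows "card X \<ge> 5"
proof (rule ccontr)
  assume "\<not> ?thesis"
  then have "card (veronese ` X) \<le> 4"
    using D card_image_le[of X veronese] by (simp add: harmonic_index_design_def)
  moreover have fin: "finite (veronese ` X)"
    using D by (simp add: harmonic_index_design_def)
  \<comment> \<open>Orthogonality to (1, 1, 1, 0, 0, 0) means trace zero. With at most four points
    there is room for this fifth condition.\<close>
  ultimately have "card (insert (1, 1, 1, 0, 0, 0) (veronese ` X)) \<le> 5"
    by (simp add: card_insert_if)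
  then obtain c where "c \<noteq> 0" "\<And>v. v \<in> insert (1, 1, 1, 0, 0, 0) (veronese ` X) \<Longrightarrow> c \<bullet> v = 0"
    using conic_through_points fin by (metis finite_insert)
  then show False
    using design_conic_trace[OF D, of c] by blast
qed

lemma design_five_points_conic_frame:
  fixes X :: "(real ^ 3) set"
  assumes D: "harmonic_index_design 4 X" and card: "card X = 5"
  obtains e1 e2 e3 :: "real ^ 3" and u v w where
    "norm e1 = 1" "norm e2 = 1" "norm e3 = 1" "e1 \<bullet> e2 = 0" "e1 \<bullet> e3 = 0" "e2 \<bullet> e3 = 0"
    "conic_frame X (\<lambda>p. p \<bullet> e1) (\<lambda>p. p \<bullet> e2) (\<lambda>p. p \<bullet> e3) u v w"
proof -
  have "finite (veronese ` X)" "card (veronese ` X) \<le> 5"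
    using D card card_image_le[of X veronese] by (simp_all add: harmonic_index_design_def)
  then obtain c where c0: "c \<noteq> 0" and cV: "\<And>v. v \<in> veronese ` X \<Longrightarrow> c \<bullet> v = 0"
    using conic_through_points by blast
  then have c: "c \<noteq> 0" "\<And>p. p \<in> X \<Longrightarrow> c \<bullet> veronese p = 0" by auto
  obtain e1 e2 e3 :: "real ^ 3" and c1 c2 c3 where
    e: "norm e1 = 1" "norm e2 = 1" "norm e3 = 1" "e1 \<bullet> e2 = 0" "e1 \<bullet> e3 = 0" "e2 \<bullet> e3 = 0"
    and v: "\<And>x. c \<bullet> veronese x = c1 * (x \<bullet> e1)\<^sup>2 + c2 * (x \<bullet> e2)\<^sup>2 + c3 * (x \<bullet> e3)\<^sup>2"
    and tr: "c1 + c2 + c3 = c \<bullet> (1, 1, 1, 0, 0, 0)" and nz: "\<not> (c1 = 0 \<and> c2 = 0 \<and> c3 = 0)"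
    using conic_diagonal[OF c(1)] by blast
  define t where "t = c1 + c2 + c3"
  have t0: "t \<noteq> 0" using design_conic_trace[OF D c] tr by (simp add: t_def)
  interpret design_frame X "\<lambda>p. p \<bullet> e1" "\<lambda>p. p \<bullet> e2" "\<lambda>p. p \<bullet> e3"
    by (rule design_frame_of_design[OF D e])
  have conic: "c1 * (p \<bullet> e1)\<^sup>2 + c2 * (p \<bullet> e2)\<^sup>2 + c3 * (p \<bullet> e3)\<^sup>2 = 0"
    "c2 * (p \<bullet> e2)\<^sup>2 + c3 * (p \<bullet> e3)\<^sup>2 + c1 * (p \<bullet> e1)\<^sup>2 = 0"
    "c3 * (p \<bullet> e3)\<^sup>2 + c1 * (p \<bullet> e1)\<^sup>2 + c2 * (p \<bullet> e2)\<^sup>2 = 0" if "p \<in> X" for p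
    using c(2)[OF that] v by simp_all
  define u v w where "u = 1 + 4 * c1 / t" and "v = 1 + 4 * c2 / t" and "w = 1 + 4 * c3 / t"
  have ut: "t * u = t + 4 * c1" "t * v = t + 4 * c2" "t * w = t + 4 * c3"
    using t0 by (simp_all add: u_def v_def w_def field_simps)
  have moments: "u * (\<Sum>p\<in>X. (p \<bullet> e1) ^ 4) = 3 / 7" "v * (\<Sum>p\<in>X. (p \<bullet> e2) ^ 4) = 3 / 7"
    "w * (\<Sum>p\<in>X. (p \<bullet> e3) ^ 4) = 3 / 7"
  proof -
    have scale: "t * (a * S) = t * (3 / 7)" if "35 * ((d1 + d2 + d3 + 4 * d1) * S) = 3 * real (card X) * (d1 + d2 + d3)"
      "d1 + d2 + d3 = t" "t * a = t + 4 * d1" for a S d1 d2 d3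
      using that unfolding card of_nat_numeral by algebra
    have "t * (u * (\<Sum>p\<in>X. (p \<bullet> e1) ^ 4)) = t * (3 / 7)"
      by (rule scale[OF conic_trace_relation[OF conic(1)] _ ut(1)]) (simp_all add: t_def)
    moreover have "t * (v * (\<Sum>p\<in>X. (p \<bullet> e2) ^ 4)) = t * (3 / 7)"
      by (rule scale[OF yzx.conic_trace_relation[OF conic(2)] _ ut(2)]) (simp_all add: t_def)
    moreover have "t * (w * (\<Sum>p\<in>X. (p \<bullet> e3) ^ 4)) = t * (3 / 7)"
      by (rule scale[OF yzx.yzx.conic_trace_relation[OF conic(3)] _ ut(3)]) (simp_all add: t_def)
    ultimately show "u * (\<Sum>p\<in>X. (p \<bullet> e1) ^ 4) = 3 / 7" "v * (\<Sum>p\<in>X. (p \<bullet> e2) ^ 4) = 3 / 7"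
      "w * (\<Sum>p\<in>X. (p \<bullet> e3) ^ 4) = 3 / 7"
      using t0 by simp_all
  qed
  have pos: "u > 0" "v > 0" "w > 0"
  proof -
    have pos: "a > 0" if "a * b = 3 / 7" "b > 0" for a b :: real
      by (rule zero_less_mult_pos2[of a b]) (simp_all only: that zero_less_divide_iff zero_less_numeral simp_thms)
    show "u > 0" by (rule pos[OF moments(1) fourth_moment_pos])
    show "v > 0" by (rule pos[OF moments(2) yzx.fourth_moment_pos])
    show "w > 0" by (rule pos[OF moments(3) yzx.yzx.fourth_moment_pos])
  qed
  have products: "(\<Sum>p\<in>X. p \<bullet> e1 * (p \<bullet> e2)) = 0" "(\<Sum>p\<in>X. p \<bullet> e2 * (p \<bullet> e3)) = 0"
    "(\<Sum>p\<in>X. p \<bullet> e3 * (p \<bullet> e1)) = 0"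
  proof -
    \<comment> \<open>The factors in the product relations are multiples of u + v, v + w and w + u,
      which are nonzero by positivity.\<close>
    have "2 * (3 * c1 + 3 * c2 + c3) = t * (u + v)" "2 * (3 * c2 + 3 * c3 + c1) = t * (v + w)"
      "2 * (3 * c3 + 3 * c1 + c2) = t * (w + u)"
      unfolding distrib_left ut by (simp_all add: t_def)
    moreover have "t * (u + v) \<noteq> 0" "t * (v + w) \<noteq> 0" "t * (w + u) \<noteq> 0"
      using pos t0 by simp_all
    ultimately have "3 * c1 + 3 * c2 + c3 \<noteq> 0" "3 * c2 + 3 * c3 + c1 \<noteq> 0" "3 * c3 + 3 * c1 + c2 \<noteq> 0"
      by (metis mult_zero_right)+
    then show "(\<Sum>p\<in>X. p \<bullet> e1 * (p \<bullet> e2)) = 0" "(\<Sum>p\<in>X. p \<bullet> e2 * (p \<bullet> e3)) = 0"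
      "(\<Sum>p\<in>X. p \<bullet> e3 * (p \<bullet> e1)) = 0"
      using conic_product_relation[OF conic(1)] yzx.conic_product_relation[OF conic(2)]
        yzx.yzx.conic_product_relation[OF conic(3)] by simp_all
  qed
  have "conic_frame X (\<lambda>p. p \<bullet> e1) (\<lambda>p. p \<bullet> e2) (\<lambda>p. p \<bullet> e3) u v w"
  proof (intro conic_frame.intro conic_frame_axioms.intro)
    have "t * (u + v + w) = t * 7" unfolding distrib_left ut by (simp add: t_def)
    then show "u + v + w = 7" using t0 by simp
    fix p assume p: "p \<in> X"
    have "t * (u * (p \<bullet> e1)\<^sup>2 + v * (p \<bullet> e2)\<^sup>2 + w * (p \<bullet> e3)\<^sup>2) = t * 1"
      using conic(1)[OF p] unit[OF p] ut by algebra
    then show "u * (p \<bullet> e1)\<^sup>2 + v * (p \<bullet> e2)\<^sup>2 + w * (p \<bullet> e3)\<^sup>2 = 1" using t0 by simp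
  qed (fact design_frame_axioms card moments products)+
  then show ?thesis by (rule that[OF e])
qed

lemma five_point_design_congruent:
  fixes X :: "(real ^ 3) set"
  assumes "harmonic_index_design 4 X" "card X = 5"
  shows "\<exists>X0\<in>{X0_plus, X0_minus}. \<exists>Y. antipodal_replacement X0 Y \<and> congruent_sets X Y"
proof -
  obtain e1 e2 e3 :: "real ^ 3" and u v w where
    e: "norm e1 = 1" "norm e2 = 1" "norm e3 = 1" "e1 \<bullet> e2 = 0" "e1 \<bullet> e3 = 0" "e2 \<bullet> e3 = 0"
    and fr: "conic_frame X (\<lambda>p. p \<bullet> e1) (\<lambda>p. p \<bullet> e2) (\<lambda>p. p \<bullet> e3) u v w"
    using design_five_points_conic_frame[OF assms] by blast
  have e': "e2 \<bullet> e1 = 0" "e3 \<bullet> e1 = 0" "e3 \<bullet> e2 = 0" using e by (simp_all add: inner_commute)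
  note fr2 = conic_frame.conic_frame_rotate[OF fr]
  note fr3 = conic_frame.conic_frame_rotate[OF fr2]
  \<comment> \<open>The frame is rotated so that the axis of the remaining parameter comes
    first.\<close>
  consider "u = v" | "v = w" | "w = u" using conic_frame.two_equal[OF fr] by blast
  then show ?thesis
  proof cases
    case 1
    show ?thesis
      by (rule two_equal_frame_congruent[OF e(3,1,2) e'(2,3) e(4)]) (use fr3 1 in simp)
  next
    case 2
    show ?thesis
      by (rule two_equal_frame_congruent[OF e]) (use fr 2 in simp)
  next
    case 3
    show ?thesis
      by (rule two_equal_frame_congruent[OF e(2,3,1) e(6) e'(1,2)]) (use fr2 3 in simp)
  qed
qed

subsection \<open>The pentagon is a design\<close>

lemma homogeneous_quartic_expansion:
  fixes f :: "real ^ 3 \<Rightarrow> real"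
  assumes "f \<in> homogeneous_polys 4"
  obtains c where "\<And>x. f x = (\<Sum>i\<le>4. \<Sum>j\<le>4 - i. c i j * ((x $ 1) ^ i * (x $ 2) ^ j * (x $ 3) ^ (4 - i - j)))"
proof -
  obtain C where C: "\<And>x. f x = (\<Sum>a | (\<Sum>i\<in>UNIV. a i) = 4. C a * (\<Prod>i\<in>UNIV. (x $ i) ^ a i))"
    using assms unfolding homogeneous_polys_def by blast
  \<comment> \<open>The truncated subtraction is exact here, since the index set bounds the first
    two exponents by a total of 4.\<close>
  define h where "h p = (\<lambda>k :: 3. if k = 1 then fst p else if k = 2 then snd p else 4 - fst p - snd p)"
    for p :: "nat \<times> nat"
  have h: "h p 1 = fst p" "h p 2 = snd p" "h p 3 = 4 - fst p - snd p" for p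
    by (simp_all add: h_def)
  have bij: "bij_betw h (SIGMA i:{..4}. {..4 - i}) {a. (\<Sum>i\<in>UNIV. a i) = 4}"
  proof (rule bij_betw_byWitness[where f' = "\<lambda>a. (a 1, a 2)"])
    show "\<forall>a\<in>{a. (\<Sum>i\<in>UNIV. a i) = 4}. h (a 1, a 2) = a"
    proof (intro ballI ext)
      fix a :: "3 \<Rightarrow> nat" and k assume "a \<in> {a. (\<Sum>i\<in>UNIV. a i) = 4}"
      then show "h (a 1, a 2) k = a k"
        using exhaust_3[of k] by (auto simp: h sum_3)
    qed
  qed (auto simp: h sum_3)
  have prod3: "(\<Prod>i\<in>UNIV. g i) = g 1 * g 2 * g 3" for g :: "3 \<Rightarrow> real"
    unfolding UNIV_3 by simp
  have "f x = (\<Sum>i\<le>4. \<Sum>j\<le>4 - i. C (h (i, j)) * ((x $ 1) ^ i * (x $ 2) ^ j * (x $ 3) ^ (4 - i - j)))" for x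
    unfolding C sum.reindex_bij_betw[OF bij, symmetric]
    by (simp add: sum.Sigma prod3 h case_prod_beta)
  then show thesis by (rule that)
qed

lemma second_deriv_quartic:
  fixes g :: "real \<Rightarrow> real"
  assumes "\<And>s. g s = p + q * s + r * s ^ 2 + m * s ^ 3 + n * s ^ 4"
  shows "(deriv ^^ 2) g 0 = 2 * r"
proof (rule second_deriv_eq)
  show "(g has_real_derivative q + 2 * r * s + 3 * m * s ^ 2 + 4 * n * s ^ 3) (at s)" for s
    unfolding assms[abs_def] by (auto intro!: derivative_eq_intros)
  show "((\<lambda>s. q + 2 * r * s + 3 * m * s ^ 2 + 4 * n * s ^ 3) has_real_derivative 2 * r) (at 0)"
    by (auto intro!: derivative_eq_intros)
qed

text \<open>Mirror images are paired so that odd powers of the last coordinate cancel.\<close>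

lemma sum_pentagon_dirs:
  fixes F :: "real \<times> real \<Rightarrow> real"
  shows "sum F pentagon_dirs = F (1, 0)
    + (F ((sqrt 5 - 1) / 4, sqrt (10 + 2 * sqrt 5) / 4) + F ((sqrt 5 - 1) / 4, - sqrt (10 + 2 * sqrt 5) / 4))
    + (F (- (sqrt 5 + 1) / 4, sqrt (10 - 2 * sqrt 5) / 4) + F (- (sqrt 5 + 1) / 4, - sqrt (10 - 2 * sqrt 5) / 4))"
proof -
  have "distinct [(1 :: real, 0 :: real),
    ((sqrt 5 - 1) / 4, sqrt (10 + 2 * sqrt 5) / 4), (- (sqrt 5 + 1) / 4, sqrt (10 - 2 * sqrt 5) / 4),
    (- (sqrt 5 + 1) / 4, - sqrt (10 - 2 * sqrt 5) / 4), ((sqrt 5 - 1) / 4, - sqrt (10 + 2 * sqrt 5) / 4)]"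
    (is "distinct ?l")
    using card_pentagon_dirs by (intro card_distinct) (simp add: pentagon_dirs_def)
  then have "sum F (set ?l) = sum_list (map F ?l)" by (rule sum.distinct_set_conv_list)
  then show ?thesis by (simp add: pentagon_dirs_def)
qed

text \<open>Summation over the pentagon retains only the axially symmetric part of a quartic. For a
  harmonic quartic this is a multiple of the zonal one, which vanishes at the chosen height.\<close>

lemma pentagon_design: "harmonic_index_design 4 X0_plus"
proof -
  define H where "H = (15 + 2 * sqrt 30) / 35"
  have "sqrt 30 < 10" by (rule real_less_lsqrt) auto
  then have H: "0 < H" "H < 1" by (simp_all add: H_def add_pos_nonneg)
  have H2: "35 * H\<^sup>2 - 30 * H + 3 = 0"
    by (simp add: H_def power2_eq_square field_simps)
  have X0: "X0_plus = pentagon_point H ` pentagon_dirs"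
    unfolding X0_plus_def H_def using pentagon_eq[of 1] by simp
  define h \<rho> where "h = sqrt H" and "\<rho> = sqrt (1 - H)"
  have h: "h\<^sup>2 = H" "\<rho>\<^sup>2 = 1 - H" using H by (simp_all add: h_def \<rho>_def)
  have point: "pentagon_point H d $ 1 = h" "pentagon_point H d $ 2 = \<rho> * fst d" "pentagon_point H d $ 3 = \<rho> * snd d" for d
    by (simp_all add: pentagon_point_def h_def \<rho>_def)
  have "norm x = 1" if "x \<in> X0_plus" for x
  proof -
    obtain a b where ab: "(a, b) \<in> pentagon_dirs" and x: "x = pentagon_point H (a, b)"
      using \<open>x \<in> X0_plus\<close> unfolding X0 by auto
    have "x \<bullet> x = h\<^sup>2 + \<rho>\<^sup>2 * (a\<^sup>2 + b\<^sup>2)"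
      unfolding x inner_vec_def sum_3 point by (simp add: power2_eq_square algebra_simps)
    also have "\<dots> = 1" using ab pentagon_dirs_iff[of a b] h by simp
    finally show ?thesis by (simp add: norm_eq_1)
  qed
  moreover have "(\<Sum>x\<in>X0_plus. f x) = 0" if "f \<in> Harm 4" for f
  proof -
    have hom: "f \<in> homogeneous_polys 4" and lap: "\<And>x. laplacian f x = 0"
      using that by (simp_all add: Harm_def)
    obtain C where C: "\<And>x. f x = (\<Sum>i\<le>4. \<Sum>j\<le>4 - i. C i j * ((x $ 1) ^ i * (x $ 2) ^ j * (x $ 3) ^ (4 - i - j)))"
      using homogeneous_quartic_expansion[OF hom] by blast
    define P where "P a b c = C 4 0 * a ^ 4 + C 3 1 * (a ^ 3 * b) + C 3 0 * (a ^ 3 * c)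
      + C 2 2 * (a\<^sup>2 * b\<^sup>2) + C 2 1 * (a\<^sup>2 * b * c) + C 2 0 * (a\<^sup>2 * c\<^sup>2)
      + C 1 3 * (a * b ^ 3) + C 1 2 * (a * b\<^sup>2 * c) + C 1 1 * (a * b * c\<^sup>2) + C 1 0 * (a * c ^ 3)
      + C 0 4 * b ^ 4 + C 0 3 * (b ^ 3 * c) + C 0 2 * (b\<^sup>2 * c\<^sup>2) + C 0 1 * (b * c ^ 3) + C 0 0 * c ^ 4" for a b c
    have f: "f x = P (x $ 1) (x $ 2) (x $ 3)" for x
    proof -
      have "{..4::nat} = {0, 1, 2, 3, 4}" "{..3::nat} = {0, 1, 2, 3}" "{..2::nat} = {0, 1, 2}" "{..1::nat} = {0, 1}"
        by auto
      then show ?thesis unfolding C P_def by (simp add: algebra_simps)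
    qed
    \<comment> \<open>Evaluating the Laplacian at the three axis vectors yields the only linear
      relations needed among the coefficients.\<close>
    have lap1: "12 * C 4 0 + 2 * C 2 2 + 2 * C 2 0 = 0"
    proof -
      have "(deriv ^^ 2) (\<lambda>s. f (axis 1 1 + s *\<^sub>R axis 1 1)) 0 = 2 * (6 * C 4 0)"
        by (rule second_deriv_quartic[where p = "C 4 0" and q = "4 * C 4 0" and m = "4 * C 4 0" and n = "C 4 0"])
          (simp add: f P_def axis_def power2_eq_square power3_eq_cube power4_eq_xxxx algebra_simps)
      moreover have "(deriv ^^ 2) (\<lambda>s. f (axis 1 1 + s *\<^sub>R axis 2 1)) 0 = 2 * C 2 2"
        by (rule second_deriv_quartic[where p = "C 4 0" and q = "C 3 1" and m = "C 1 3" and n = "C 0 4"])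
          (simp add: f P_def axis_def)
      moreover have "(deriv ^^ 2) (\<lambda>s. f (axis 1 1 + s *\<^sub>R axis 3 1)) 0 = 2 * C 2 0"
        by (rule second_deriv_quartic[where p = "C 4 0" and q = "C 3 0" and m = "C 1 0" and n = "C 0 0"])
          (simp add: f P_def axis_def)
      ultimately show ?thesis using lap[of "axis 1 1"] by (simp add: laplacian_def sum_3)
    qed
    have lap2: "2 * C 2 2 + 12 * C 0 4 + 2 * C 0 2 = 0"
    proof -
      have "(deriv ^^ 2) (\<lambda>s. f (axis 2 1 + s *\<^sub>R axis 1 1)) 0 = 2 * C 2 2"
        by (rule second_deriv_quartic[where p = "C 0 4" and q = "C 1 3" and m = "C 3 1" and n = "C 4 0"])
          (simp add: f P_def axis_def)
      moreover have "(deriv ^^ 2) (\<lambda>s. f (axis 2 1 + s *\<^sub>R axis 2 1)) 0 = 2 * (6 * C 0 4)"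
        by (rule second_deriv_quartic[where p = "C 0 4" and q = "4 * C 0 4" and m = "4 * C 0 4" and n = "C 0 4"])
          (simp add: f P_def axis_def power2_eq_square power3_eq_cube power4_eq_xxxx algebra_simps)
      moreover have "(deriv ^^ 2) (\<lambda>s. f (axis 2 1 + s *\<^sub>R axis 3 1)) 0 = 2 * C 0 2"
        by (rule second_deriv_quartic[where p = "C 0 4" and q = "C 0 3" and m = "C 0 1" and n = "C 0 0"])
          (simp add: f P_def axis_def)
      ultimately show ?thesis using lap[of "axis 2 1"] by (simp add: laplacian_def sum_3)
    qed
    have lap3: "2 * C 2 0 + 2 * C 0 2 + 12 * C 0 0 = 0"
    proof -
      have "(deriv ^^ 2) (\<lambda>s. f (axis 3 1 + s *\<^sub>R axis 1 1)) 0 = 2 * C 2 0"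
        by (rule second_deriv_quartic[where p = "C 0 0" and q = "C 1 0" and m = "C 3 0" and n = "C 4 0"])
          (simp add: f P_def axis_def)
      moreover have "(deriv ^^ 2) (\<lambda>s. f (axis 3 1 + s *\<^sub>R axis 2 1)) 0 = 2 * C 0 2"
        by (rule second_deriv_quartic[where p = "C 0 0" and q = "C 0 1" and m = "C 0 3" and n = "C 0 4"])
          (simp add: f P_def axis_def)
      moreover have "(deriv ^^ 2) (\<lambda>s. f (axis 3 1 + s *\<^sub>R axis 3 1)) 0 = 2 * (6 * C 0 0)"
        by (rule second_deriv_quartic[where p = "C 0 0" and q = "4 * C 0 0" and m = "4 * C 0 0" and n = "C 0 0"])
          (simp add: f P_def axis_def power2_eq_square power3_eq_cube power4_eq_xxxx algebra_simps)
      ultimately show ?thesis using lap[of "axis 3 1"] by (simp add: laplacian_def sum_3)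
    qed
    \<comment> \<open>The contribution of a mirror pair, with the square of the last coordinate
      replaced by 1 - a^2.\<close>
    define E where "E a = 2 * (C 4 0 * h ^ 4 + C 3 1 * (h ^ 3 * \<rho> * a) + C 2 2 * (h\<^sup>2 * \<rho>\<^sup>2 * a\<^sup>2)
      + C 2 0 * (h\<^sup>2 * \<rho>\<^sup>2 * (1 - a\<^sup>2)) + C 1 3 * (h * \<rho> ^ 3 * a ^ 3) + C 1 1 * (h * \<rho> ^ 3 * a * (1 - a\<^sup>2))
      + \<rho> ^ 4 * (C 0 4 * a ^ 4 + C 0 2 * (a\<^sup>2 * (1 - a\<^sup>2)) + C 0 0 * (1 - a\<^sup>2)\<^sup>2))" for a
    have even: "P h (\<rho> * a) (\<rho> * b) + P h (\<rho> * a) (\<rho> * - b) = E a" if "(a, b) \<in> pentagon_dirs" for a b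
    proof -
      have "b\<^sup>2 = 1 - a\<^sup>2" using that pentagon_dirs_iff[of a b] by simp
      then show ?thesis unfolding P_def E_def by algebra
    qed
    have "(\<Sum>x\<in>X0_plus. f x) = (\<Sum>d\<in>pentagon_dirs. P h (\<rho> * fst d) (\<rho> * snd d))"
      unfolding X0 using pentagon_point_inj[OF H(2)]
      by (subst sum.reindex) (auto simp: f point intro: inj_on_subset)
    also have "\<dots> = P h \<rho> 0 + E ((sqrt 5 - 1) / 4) + E (- (sqrt 5 + 1) / 4)"
    proof -
      have "((sqrt 5 - 1) / 4, sqrt (10 + 2 * sqrt 5) / 4) \<in> pentagon_dirs"
        "(- (sqrt 5 + 1) / 4, sqrt (10 - 2 * sqrt 5) / 4) \<in> pentagon_dirs"
        unfolding pentagon_dirs_def by blast+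
      from this[THEN even] show ?thesis
        unfolding sum_pentagon_dirs fst_conv snd_conv minus_divide_left by simp
    qed
    also have "\<dots> = 0"
    proof -
      define p q where "p = (sqrt 5 - 1) / 4" and "q = - (sqrt 5 + 1) / 4"
      have "p + q = - (1 / 2)" "p * q = - (1 / 4)" by (simp_all add: p_def q_def field_simps)
      then have m: "q = - (1 / 2) - p" "4 * p\<^sup>2 = 1 - 2 * p" by algebra+
      \<comment> \<open>The relations for \<open>p\<close> and \<open>q\<close> reduce all cosine
        power sums over the pentagon: the odd ones vanish, and the means of squares and fourth
        powers are 1/2 and 3/8.\<close>
      have "P h \<rho> 0 + E p + E q = 5 * (C 4 0 * h ^ 4 + (C 2 2 + C 2 0) / 2 * (h\<^sup>2 * \<rho>\<^sup>2)
          + \<rho> ^ 4 * (3 * C 0 4 + 3 * C 0 0 + C 0 2) / 8)"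
        unfolding P_def E_def m(1) using m(2) by (simp add: field_simps) algebra
      also have "\<dots> = 5 * C 4 0 * (h ^ 4 - 3 * h\<^sup>2 * \<rho>\<^sup>2 + 3 / 8 * \<rho> ^ 4)"
      proof -
        have "C 2 2 + C 2 0 = - 6 * C 4 0" "3 * C 0 4 + 3 * C 0 0 + C 0 2 = 3 * C 4 0"
          using lap1 lap2 lap3 by algebra+
        then show ?thesis by (simp add: algebra_simps)
      qed
      \<comment> \<open>Eight times this expression is 35 H^2 - 30 H + 3.\<close>
      also have "h ^ 4 - 3 * h\<^sup>2 * \<rho>\<^sup>2 + 3 / 8 * \<rho> ^ 4 = 0"
      proof -
        have 4: "h ^ 4 = H\<^sup>2" "\<rho> ^ 4 = (1 - H)\<^sup>2"
          using power_mult[of h 2 2] power_mult[of \<rho> 2 2] by (simp_all add: h)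
        have "8 * h ^ 4 - 24 * h\<^sup>2 * \<rho>\<^sup>2 + 3 * \<rho> ^ 4 = 0"
          unfolding 4 h using H2 by (simp add: power2_eq_square algebra_simps)
        then show ?thesis by (simp add: field_simps)
      qed
      finally show ?thesis by (simp add: p_def q_def)
    qed
    finally show ?thesis .
  qed
  moreover have "finite X0_plus" "X0_plus \<noteq> {}"
    by (simp_all add: X0 pentagon_dirs_def)
  ultimately show ?thesis
    by (auto simp: harmonic_index_design_def)
qed

lemma card_X0_plus: "card X0_plus = 5"
proof -
  have "sqrt 30 < 10" by (rule real_less_lsqrt) auto
  then show ?thesis
    unfolding X0_plus_def pentagon_eq[of 1, simplified]
    using pentagon_point_inj[of "(15 + 2 * sqrt 30) / 35"] card_pentagon_dirs
    by (simp add: card_image inj_on_subset)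
qed

section \<open>The minimum and the classification\<close>

theorem theorem3:
  "min_design_card TYPE(3) 4 = 5 \<and>
   (\<forall>X :: (real ^ 3) set. harmonic_index_design 4 X \<and> card X = 5 \<longrightarrow>
      (\<exists>X0\<in>{X0_plus, X0_minus}. \<exists>Y. antipodal_replacement X0 Y \<and> congruent_sets X Y))"
proof
  have "5 \<in> card ` {X :: (real ^ 3) set. harmonic_index_design 4 X}"
    using pentagon_design card_X0_plus by (metis (mono_tags) image_eqI mem_Collect_eq)
  then show "min_design_card TYPE(3) 4 = 5"
    unfolding min_design_card_def
    by (rule cInf_eq_minimum) (auto intro: design_card_ge_5)
qed (use five_point_design_congruent in blast)

end
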